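(* There exists a randomized polynomial-time online algorithm for Online Submodular Welfare Maximization, in the case where every agent's utility function is the rank function of a matroid, which is $(1-\frac1e)$-competitive: on every instance, the expected welfare of its allocation is at least $(1-\frac1e)$ times the welfare of an optimal offline allocation.
   Context: Online Submodular Welfare Maximization (OSWM) with matroid rank utilities: there are $n$ agents and $m$ indivisible items. Agent $i$ has utility function $f_i=\mathrm{rank}_{\mathcal M_i}:2^{[m]}\to\mathbb{Z}_{\ge 0}$, the rank function of a matroid $\mathcal M_i$ on ground set $[m]$; the algorithm can query $f_i(S)$ for any $i$ and $S$ (value oracle). Items arrive online one at a time (adversarial order), and upon arrival each item must be irrevocably assigned to some agent. If $U_i$ is the set of items assigned to agent $i$, the welfare is $\sum_{i=1}^n f_i(U_i)$. The optimal offline allocation is the welfare-maximizing assignment of all items with full knowledge in advance. *)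

theory Defs
  imports "HOL-Probability.Probability" "HOL-Computational_Algebra.Polynomial"
begin

section \<open>Matroids and their rank functions\<close>

locale matroid =
  fixes carrier :: "'a set" and indep :: "'a set \<Rightarrow> bool"
  assumes finite_carrier: "finite carrier"
    and indep_subset_carrier: "indep X \<Longrightarrow> X \<subseteq> carrier"
    and indep_empty: "indep {}"
    and indep_subset: "indep X \<Longrightarrow> Y \<subseteq> X \<Longrightarrow> indep Y"
    and augment: "indep X \<Longrightarrow> indep Y \<Longrightarrow> card Y < card X \<Longrightarrow> \<exists>x\<in>X - Y. indep (insert x Y)"

definition matroid_rank :: "('a set \<Rightarrow> bool) \<Rightarrow> 'a set \<Rightarrow> nat" where
  "matroid_rank indep S = Max (card ` {X. X \<subseteq> S \<and> indep X})"

section \<open>Instances of submodular welfare maximization\<close>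

text \<open>The agents are \<open>{..<n}\<close> and the items are \<open>{..<m}\<close>; \<open>f i\<close> is the utility function of
  agent \<open>i\<close>, of which only the values on subsets of \<open>{..<m}\<close> matter. An agent must exist, since
  otherwise no item can be assigned.\<close>

definition matroid_rank_utilities :: "nat \<Rightarrow> nat \<Rightarrow> (nat \<Rightarrow> nat set \<Rightarrow> nat) \<Rightarrow> bool" where
  "matroid_rank_utilities n m f \<longleftrightarrow> 0 < n \<and>
     (\<forall>i<n. \<exists>indep. matroid {..<m} indep \<and> (\<forall>S\<subseteq>{..<m}. f i S = matroid_rank indep S))"

definition welfare :: "nat \<Rightarrow> nat \<Rightarrow> (nat \<Rightarrow> nat set \<Rightarrow> nat) \<Rightarrow> (nat \<Rightarrow> nat) \<Rightarrow> nat" where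
  "welfare n m f \<sigma> = (\<Sum>i<n. f i {j. j < m \<and> \<sigma> j = i})"

definition optimal_welfare :: "nat \<Rightarrow> nat \<Rightarrow> (nat \<Rightarrow> nat set \<Rightarrow> nat) \<Rightarrow> nat" where
  "optimal_welfare n m f = Max (welfare n m f ` ({..<m} \<rightarrow>\<^sub>E {..<n}))"

section \<open>Randomized programs with a value oracle\<close>

text \<open>A unit-cost random access machine, presented as a structured language. Memory consists of
  natural-number variables and of arrays with two indices. Addition and truncated subtraction are
  the only arithmetic operations (in particular there is no unit-cost multiplication), so within
  \<open>T\<close> steps all numbers keep a bit length of \<open>O(T)\<close> plus that of the input; up to a polynomial,
  the step count is therefore the usual notion of running time.\<close>

type_synonym name = string

record state =
  var :: "name \<Rightarrow> nat"
  arr :: "name \<Rightarrow> nat \<Rightarrow> nat \<Rightarrow> nat"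

datatype aexp =
    Const nat
  | Var name
  | Read name aexp aexp
  | Plus aexp aexp
  | Minus aexp aexp

primrec aval :: "aexp \<Rightarrow> state \<Rightarrow> nat" where
  "aval (Const k) s = k"
| "aval (Var x) s = var s x"
| "aval (Read a d e) s = arr s a (aval d s) (aval e s)"
| "aval (Plus d e) s = aval d s + aval e s"
| "aval (Minus d e) s = aval d s - aval e s"

datatype bexp =
    Less aexp aexp
  | Neg bexp
  | Conj bexp bexp

primrec bval :: "bexp \<Rightarrow> state \<Rightarrow> bool" where
  "bval (Less d e) s \<longleftrightarrow> aval d s < aval e s"
| "bval (Neg b) s \<longleftrightarrow> \<not> bval b s"
| "bval (Conj b c) s \<longleftrightarrow> bval b s \<and> bval c s"

datatype com =
    Skip
  | Assign name aexp
  | Store name aexp aexp aexp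
  | Draw name aexp
  | Query name aexp name aexp
  | Seq com com
  | Cond bexp com com
  | While bexp com

definition set_var :: "name \<Rightarrow> nat \<Rightarrow> state \<Rightarrow> state" where
  "set_var x v s = s\<lparr>var := (var s)(x := v)\<rparr>"

definition set_arr :: "name \<Rightarrow> nat \<Rightarrow> nat \<Rightarrow> nat \<Rightarrow> state \<Rightarrow> state" where
  "set_arr a i j v s = s\<lparr>arr := (arr s)(a := (arr s a)(i := (arr s a i)(j := v)))\<rparr>"

text \<open>One step of a configuration, i.e. of a stack of pending commands together with a state; the
  program has halted when the stack is empty. \<open>Draw x e\<close> draws \<open>x\<close> uniformly from \<open>{0..e}\<close>.
  \<open>Query x e a r\<close> asks the oracle \<open>g\<close> for the value, to agent \<open>e\<close>, of the set whose
  characteristic vector is stored in row \<open>r\<close> of array \<open>a\<close>.\<close>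

type_synonym config = "com list \<times> state"

fun step :: "(nat \<Rightarrow> nat set \<Rightarrow> nat) \<Rightarrow> config \<Rightarrow> config pmf" where
  "step g ([], s) = return_pmf ([], s)"
| "step g (Skip # cs, s) = return_pmf (cs, s)"
| "step g (Assign x e # cs, s) = return_pmf (cs, set_var x (aval e s) s)"
| "step g (Store a d e v # cs, s) =
     return_pmf (cs, set_arr a (aval d s) (aval e s) (aval v s) s)"
| "step g (Draw x e # cs, s) =
     map_pmf (\<lambda>v. (cs, set_var x v s)) (pmf_of_set {0..aval e s})"
| "step g (Query x e a r # cs, s) =
     return_pmf (cs, set_var x (g (aval e s) {t. arr s a (aval r s) t \<noteq> 0}) s)"
| "step g (Seq c d # cs, s) = return_pmf (c # d # cs, s)"
| "step g (Cond b c d # cs, s) = return_pmf ((if bval b s then c else d) # cs, s)"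
| "step g (While b c # cs, s) =
     return_pmf (if bval b s then c # While b c # cs else cs, s)"

primrec steps :: "(nat \<Rightarrow> nat set \<Rightarrow> nat) \<Rightarrow> nat \<Rightarrow> config \<Rightarrow> config pmf" where
  "steps g 0 q = return_pmf q"
| "steps g (Suc T) q = bind_pmf (step g q) (steps g T)"

section \<open>Online execution\<close>

text \<open>Item \<open>\<pi> t\<close> is the \<open>t\<close>-th to arrive, counting from 0, and programs refer to items by their
  arrival position. Once \<open>k\<close> items have arrived the oracle gives access to the utilities on
  sets of these \<open>k\<close> items only: a program that could query sets of future items could compute an
  optimal offline allocation before the first arrival.\<close>

definition value_oracle ::
    "nat \<Rightarrow> (nat \<Rightarrow> nat set \<Rightarrow> nat) \<Rightarrow> (nat \<Rightarrow> nat) \<Rightarrow> nat \<Rightarrow> nat \<Rightarrow> nat set \<Rightarrow> nat" where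
  "value_oracle n f \<pi> k i S = (if i < n then f i (\<pi> ` (S \<inter> {..<k})) else 0)"

text \<open>A program knows the number of agents but not the number of items. It is run once per arrival,
  keeps its memory between arrivals, and leaves in variable \<open>agent\<close> the agent who receives the
  item. A run that has not halted after \<open>T\<close> steps, or names no existing agent, fails; failure is
  the missing probability mass of the subdistribution.\<close>

definition initial_state :: "nat \<Rightarrow> state" where
  "initial_state n = set_var ''agents'' n \<lparr>var = (\<lambda>_. 0), arr = (\<lambda>_ _ _. 0)\<rparr>"

definition serve ::
    "com \<Rightarrow> nat \<Rightarrow> (nat \<Rightarrow> nat set \<Rightarrow> nat) \<Rightarrow> (nat \<Rightarrow> nat) \<Rightarrow> nat \<Rightarrow> nat \<Rightarrow> state \<Rightarrow> state spmf" where
  "serve c n f \<pi> T t s =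
     map_pmf (\<lambda>(cs, s'). if cs = [] \<and> var s' ''agent'' < n then Some s' else None)
       (steps (value_oracle n f \<pi> (Suc t)) T ([c], set_var ''item'' t s))"

primrec play ::
    "com \<Rightarrow> nat \<Rightarrow> (nat \<Rightarrow> nat set \<Rightarrow> nat) \<Rightarrow> (nat \<Rightarrow> nat) \<Rightarrow> nat \<Rightarrow> nat \<Rightarrow> (state \<times> (nat \<Rightarrow> nat)) spmf"
  where
  "play c n f \<pi> T 0 = return_spmf (initial_state n, \<lambda>_. undefined)"
| "play c n f \<pi> T (Suc t) =
     bind_spmf (play c n f \<pi> T t) (\<lambda>(s, \<sigma>).
       map_spmf (\<lambda>s'. (s', \<sigma>(\<pi> t := var s' ''agent''))) (serve c n f \<pi> T t s))"

definition online_allocation ::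
    "com \<Rightarrow> nat \<Rightarrow> (nat \<Rightarrow> nat set \<Rightarrow> nat) \<Rightarrow> (nat \<Rightarrow> nat) \<Rightarrow> nat \<Rightarrow> nat \<Rightarrow> (nat \<Rightarrow> nat) spmf" where
  "online_allocation c n f \<pi> T m = map_spmf snd (play c n f \<pi> T m)"

end

theory Submission
  imports Defs
begin

text \<open>The algorithm is Ranking: draw one uniformly random order of the agents, and give each item to the
  first agent whose utility it increases. Agent by agent, this is a serial dictatorship: the first
  agent greedily picks a basis of all items, the next one a basis of what is left over, and so on,
  so that an agent never influences the agents before it, and delays those after it by at most one
  position. If \<open>R a\<close> is left over after \<open>a\<close> agents, the welfare is the sum over \<open>a\<close> of the rank
  of \<open>R a\<close> for the \<open>a\<close>-th agent.

  The analysis is primal-dual. The agent in position \<open>a\<close> keeps a fraction \<open>price n a\<close> of each item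
  it picks, and the rest is credited to the item. Fix an agent \<open>i\<close>, a basis \<open>B\<close> of its optimal share, and the
  order of the others, and insert \<open>i\<close> at a uniformly random position \<open>p\<close>. Then \<open>i\<close> picks at least
  \<open>|R p \<inter> B|\<close> items, with \<open>R p\<close> not depending on \<open>i\<close>, and a recurrence satisfied by the prices
  says that its expected share together with the credit of \<open>B\<close> is at least \<open>(1 - 1/e) |B|\<close>.\<close>

section \<open>Rank functions\<close>

text \<open>Programs name items by arrival position, so the analysis needs ranks of images under the
  arrival order. These properties carry over to such images directly, without constructing a matroid
  on the positions. \<open>rank_span\<close> expresses submodularity as monotonicity of the
  closure.\<close>

locale rank_function =
  fixes m :: nat and r :: "nat set \<Rightarrow> nat"
  assumes rank_empty: "r {} = 0"
    and rank_mono: "A \<subseteq> B \<Longrightarrow> B \<subseteq> {..<m} \<Longrightarrow> r A \<le> r B"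
    and rank_insert_le: "x < m \<Longrightarrow> A \<subseteq> {..<m} \<Longrightarrow> r (insert x A) \<le> Suc (r A)"
    and rank_span: "A \<subseteq> B \<Longrightarrow> B \<subseteq> {..<m} \<Longrightarrow> x < m \<Longrightarrow> r (insert x A) = r A \<Longrightarrow> r (insert x B) = r B"

section \<open>Bases and ranks of matroids\<close>

context matroid
begin

lemma finite_indep: "indep X \<Longrightarrow> finite X"
  using finite_carrier indep_subset_carrier finite_subset by blast

lemma finite_rank_values: "finite (card ` {X. X \<subseteq> S \<and> indep X})"
proof -
  have "{X. X \<subseteq> S \<and> indep X} \<subseteq> Pow carrier"
    using indep_subset_carrier by blast
  then show ?thesis
    using finite_carrier finite_subset by blast
qed

lemma card_le_rank: "X \<subseteq> S \<Longrightarrow> indep X \<Longrightarrow> card X \<le> matroid_rank indep S"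
  unfolding matroid_rank_def using finite_rank_values by (intro Max_ge) auto

lemma basis_exists:
  obtains X where "X \<subseteq> S" "indep X" "card X = matroid_rank indep S"
proof -
  have "matroid_rank indep S \<in> card ` {X. X \<subseteq> S \<and> indep X}"
    unfolding matroid_rank_def using finite_rank_values indep_empty by (intro Max_in) auto
  then show ?thesis
    using that by auto
qed

text \<open>Take a largest independent set between \<open>I\<close> and \<open>S\<close>. Were it
  smaller than a maximum independent subset of \<open>S\<close>, augmentation would enlarge it
  inside \<open>S\<close>.\<close>

lemma basis_extension:
  assumes "I \<subseteq> S" "indep I"
  obtains J where "I \<subseteq> J" "J \<subseteq> S" "indep J" "card J = matroid_rank indep S"
proof -
  let ?P = "\<lambda>J. I \<subseteq> J \<and> J \<subseteq> S \<and> indep J"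
  have "\<forall>J. ?P J \<longrightarrow> card J < Suc (matroid_rank indep S)"
    using card_le_rank by (simp add: le_imp_less_Suc)
  moreover have "?P I"
    using assms by simp
  ultimately obtain J where J: "?P J" and max: "\<forall>K. ?P K \<longrightarrow> card K \<le> card J"
    using ex_has_greatest_nat[of ?P I card "Suc (matroid_rank indep S)"] by auto
  obtain X where X: "X \<subseteq> S" "indep X" "card X = matroid_rank indep S"
    by (rule basis_exists)
  have "\<not> card J < card X"
  proof
    assume "card J < card X"
    then obtain x where "x \<in> X - J" "indep (insert x J)"
      using augment X J by blast
    moreover have "finite J"
      using J finite_indep by blast
    ultimately show False
      using max X J by (auto dest!: spec[of _ "insert x J"])
  qed
  then have "card J = matroid_rank indep S"
    using X card_le_rank J by (simp add: antisym)
  then show ?thesis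
    using J that by blast
qed

lemma matroid_rank_empty: "matroid_rank indep {} = 0"
  by (metis basis_exists card.empty subset_empty)

lemma matroid_rank_mono: "A \<subseteq> B \<Longrightarrow> matroid_rank indep A \<le> matroid_rank indep B"
  by (metis basis_exists card_le_rank subset_trans)

lemma matroid_rank_insert_le: "matroid_rank indep (insert x A) \<le> Suc (matroid_rank indep A)"
proof -
  obtain X where X: "X \<subseteq> insert x A" "indep X" "card X = matroid_rank indep (insert x A)"
    by (rule basis_exists)
  have "indep (X - {x})"
    using X indep_subset by blast
  then have "card (X - {x}) \<le> matroid_rank indep A"
    using X by (intro card_le_rank) auto
  then show ?thesis
    using X(3) finite_indep[OF X(2)] by (cases "x \<in> X") (auto simp: card_Diff_singleton_if)
qed

text \<open>If \<open>x\<close> raised the rank of \<open>B\<close>, a basis \<open>J\<close> of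
  \<open>B\<close> extending a basis \<open>I\<close> of \<open>A\<close> could be augmented. The
  new element cannot lie in \<open>B\<close>, where \<open>J\<close> is already maximum, so it is
  \<open>x\<close>. Then \<open>insert x I\<close> is independent and too large for the rank of
  \<open>insert x A\<close>.\<close>

lemma matroid_rank_span:
  assumes "A \<subseteq> B" and span: "matroid_rank indep (insert x A) = matroid_rank indep A"
  shows "matroid_rank indep (insert x B) = matroid_rank indep B"
proof (rule ccontr)
  assume "\<not> ?thesis"
  then have gt: "matroid_rank indep B < matroid_rank indep (insert x B)"
    using matroid_rank_mono[of B "insert x B"] by (simp add: order_less_le subset_insertI)
  then have "x \<notin> B"
    by (metis insert_absorb less_irrefl)
  obtain I where I: "I \<subseteq> A" "indep I" "card I = matroid_rank indep A"
    by (rule basis_exists)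
  obtain J where J: "I \<subseteq> J" "J \<subseteq> B" "indep J" "card J = matroid_rank indep B"
    using basis_extension[of I B] I assms by blast
  obtain K where K: "K \<subseteq> insert x B" "indep K" "card K = matroid_rank indep (insert x B)"
    by (rule basis_exists)
  obtain y where y: "y \<in> K - J" "indep (insert y J)"
    using augment[of K J] K J gt by auto
  have "card (insert y J) = Suc (card J)"
    using y finite_indep[OF J(3)] by simp
  then have "\<not> insert y J \<subseteq> B"
    using card_le_rank[OF _ y(2), of B] J by auto
  then have "y = x"
    using y K J by auto
  then have "indep (insert x I)"
    using indep_subset[OF y(2)] Set.insert_mono[OF J(1)] by simp
  then have "card (insert x I) \<le> matroid_rank indep A"
    using card_le_rank[of "insert x I" "insert x A"] subset_insertI2[OF I(1)] span
    by simp
  moreover have "x \<notin> I"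
    using subsetD[OF \<open>A \<subseteq> B\<close>] subsetD[OF I(1)] \<open>x \<notin> B\<close> by auto
  ultimately show False
    using I(3) finite_indep[OF I(2)] by simp
qed

end

lemma rank_function_image:
  assumes "matroid {..<m} indep" and f: "\<And>S. S \<subseteq> {..<m} \<Longrightarrow> f S = matroid_rank indep S"
    and \<pi>: "\<pi> ` {..<m} \<subseteq> {..<m}"
  shows "rank_function m (\<lambda>S. f (\<pi> ` S))"
proof -
  interpret matroid "{..<m}" indep by fact
  have *: "f (\<pi> ` S) = matroid_rank indep (\<pi> ` S)" if "S \<subseteq> {..<m}" for S
    using that \<pi> by (intro f) blast
  show ?thesis
  proof
    show "f (\<pi> ` {}) = 0"
      by (simp add: f matroid_rank_empty)
  next
    fix A B :: "nat set"
    assume "A \<subseteq> B" "B \<subseteq> {..<m}"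
    then show "f (\<pi> ` A) \<le> f (\<pi> ` B)"
      using *[of A] *[of B] by (auto intro!: matroid_rank_mono)
  next
    fix A :: "nat set" and x
    assume "x < m" "A \<subseteq> {..<m}"
    then show "f (\<pi> ` insert x A) \<le> Suc (f (\<pi> ` A))"
      using *[of A] *[of "insert x A"] matroid_rank_insert_le by simp
  next
    fix A B :: "nat set" and x
    assume AB: "A \<subseteq> B" "B \<subseteq> {..<m}" "x < m" and "f (\<pi> ` insert x A) = f (\<pi> ` A)"
    moreover from AB have "A \<subseteq> {..<m}" "insert x A \<subseteq> {..<m}"
      by auto
    ultimately have "matroid_rank indep (insert (\<pi> x) (\<pi> ` A)) = matroid_rank indep (\<pi> ` A)"
      using *[of A] *[of "insert x A"] by simp
    then have "matroid_rank indep (insert (\<pi> x) (\<pi> ` B)) = matroid_rank indep (\<pi> ` B)"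
      by (rule matroid_rank_span[OF image_mono[OF \<open>A \<subseteq> B\<close>]])
    moreover have "insert x B \<subseteq> {..<m}"
      using AB by simp
    ultimately show "f (\<pi> ` insert x B) = f (\<pi> ` B)"
      using *[of B] *[of "insert x B"] AB(2) by simp
  qed
qed

section \<open>Serial dictatorship\<close>

text \<open>The greedy choice in arrival order. An item is tested against all earlier items on offer
  rather than the accepted ones only; \<open>picks_prefix\<close> shows that both have the same
  rank, so this is the usual greedy rule without recursion.\<close>

definition picks :: "(nat set \<Rightarrow> nat) \<Rightarrow> nat set \<Rightarrow> nat set" where
  "picks r R = {j \<in> R. r (R \<inter> {..<j}) < r (R \<inter> {..j})}"

lemma picks_subset: "picks r R \<subseteq> R"
  by (auto simp: picks_def)

context rank_function
begin

text \<open>Both halves are proved together: a rejected item changes nothing, while an accepted one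
  raises the rank of the offer and of the picks by exactly one each.\<close>

lemma picks_prefix:
  assumes "R \<subseteq> {..<m}"
  shows "r (picks r R \<inter> {..<t}) = r (R \<inter> {..<t}) \<and> card (picks r R \<inter> {..<t}) = r (R \<inter> {..<t})"
proof (induction t)
  case 0
  then show ?case by (simp add: rank_empty)
next
  case (Suc t)
  let ?P = "picks r R \<inter> {..<t}" and ?R = "R \<inter> {..<t}"
  have PR: "?P \<subseteq> ?R"
    using picks_subset by blast
  show ?case
  proof (cases "t \<in> R")
    case False
    then have "t \<notin> picks r R"
      using picks_subset by blast
    with False show ?thesis
      using Suc by (simp add: lessThan_Suc)
  next
    case True
    then have t: "t < m" and R': "R \<inter> {..t} = insert t ?R" "R \<inter> {..<Suc t} = insert t ?R"
      using assms by auto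
    show ?thesis
    proof (cases "t \<in> picks r R")
      case False
      then have "r (insert t ?R) \<le> r ?R"
        using True R'(1) by (simp add: picks_def)
      moreover have "r ?R \<le> r (insert t ?R)"
        using assms t by (intro rank_mono) auto
      ultimately have "r (insert t ?R) = r ?R"
        by simp
      with False show ?thesis
        using Suc R' by (simp add: lessThan_Suc)
    next
      case inP: True
      then have "r ?R < r (insert t ?R)"
        using R'(1) by (simp add: picks_def)
      \<comment> \<open>The contrapositive of \<open>rank_span\<close>: what raises the rank of the
        larger set raises that of the smaller one.\<close>
      moreover from this have "r (insert t ?P) \<noteq> r ?P"
        using rank_span[OF PR _ t] assms by fastforce
      moreover have "r (insert t ?R) \<le> Suc (r ?R)" "r (insert t ?P) \<le> Suc (r ?P)" "r ?P \<le> r (insert t ?P)"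
        using t assms PR by (auto intro!: rank_insert_le rank_mono)
      ultimately have "r (insert t ?R) = Suc (r ?R)" "r (insert t ?P) = Suc (r ?P)"
        by auto
      moreover have "picks r R \<inter> {..<Suc t} = insert t ?P"
        using inP by auto
      ultimately show ?thesis
        using Suc R' by simp
    qed
  qed
qed

lemma
  assumes "R \<subseteq> {..<m}"
  shows rank_picks: "r (picks r R) = r R" and card_picks: "card (picks r R) = r R"
proof -
  have "picks r R \<inter> {..<m} = picks r R" "R \<inter> {..<m} = R"
    using assms picks_subset by blast+
  then show "r (picks r R) = r R" "card (picks r R) = r R"
    using picks_prefix[OF assms, of m] by auto
qed

lemma rank_Un_le:
  assumes "finite B" "A \<subseteq> {..<m}" "B \<subseteq> {..<m}"
  shows "r (A \<union> B) \<le> r A + card B"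
  using assms
proof (induction B)
  case (insert x B)
  then have "r (insert x (A \<union> B)) \<le> Suc (r (A \<union> B))"
    by (intro rank_insert_le) auto
  then show ?case
    using insert by auto
qed simp

text \<open>Dropping \<open>B - A\<close> from the independent set \<open>B\<close> lowers the rank
  by at most \<open>card (B - A)\<close>, so \<open>A \<inter> B\<close> still has full rank. This
  bounds from below what an agent gains from the remains of its optimal basis.\<close>

lemma card_Int_le_rank:
  assumes "A \<subseteq> {..<m}" "B \<subseteq> {..<m}" "r B = card B"
  shows "card (A \<inter> B) \<le> r A"
proof -
  have fin: "finite B"
    using assms(2) finite_subset by blast
  have "r B \<le> r (A \<inter> B) + card (B - A)"
  proof -
    have "A \<inter> B \<union> (B - A) = B"
      by blast
    then show ?thesis
      using rank_Un_le[of "B - A" "A \<inter> B"] assms fin by auto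
  qed
  moreover have "card B = card (A \<inter> B) + card (B - A)"
    by (metis Int_commute card_Int_Diff fin)
  moreover have "r (A \<inter> B) \<le> r A"
    using assms by (intro rank_mono) auto
  ultimately show ?thesis
    using assms(3) by simp
qed

text \<open>A rejected item lies in the span of the earlier items of \<open>R\<close>, hence in that
  of the earlier items of \<open>S\<close>. So enlarging an offer never makes an item disappear from
  what is passed on.\<close>

lemma Diff_picks_mono:
  assumes "R \<subseteq> S" "S \<subseteq> {..<m}"
  shows "R - picks r R \<subseteq> S - picks r S"
proof
  fix j
  assume j: "j \<in> R - picks r R"
  then have jm: "j < m" "j \<in> S"
    using assms by auto
  have eq: "T \<inter> {..j} = insert j (T \<inter> {..<j})" if "j \<in> T" for T
    using that by auto
  have "r (insert j (R \<inter> {..<j})) = r (R \<inter> {..<j})"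
  proof (rule antisym)
    show "r (insert j (R \<inter> {..<j})) \<le> r (R \<inter> {..<j})"
      using j eq[of R] by (auto simp: picks_def)
    show "r (R \<inter> {..<j}) \<le> r (insert j (R \<inter> {..<j}))"
      using jm assms by (intro rank_mono) auto
  qed
  moreover have "R \<inter> {..<j} \<subseteq> S \<inter> {..<j}" "S \<inter> {..<j} \<subseteq> {..<m}"
    using assms by auto
  ultimately have "r (insert j (S \<inter> {..<j})) = r (S \<inter> {..<j})"
    using jm(1) rank_span by blast
  then show "j \<in> S - picks r S"
    using jm eq[of S] by (simp add: picks_def)
qed

end

section \<open>Left-over sets and the insertion of an agent\<close>

definition remaining :: "(nat \<Rightarrow> nat set \<Rightarrow> nat) \<Rightarrow> nat list \<Rightarrow> nat set \<Rightarrow> nat set" where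
  "remaining r L R = fold (\<lambda>i R. R - picks (r i) R) L R"

lemma remaining_simps [simp]:
  "remaining r [] R = R"
  "remaining r (i # L) R = remaining r L (R - picks (r i) R)"
  "remaining r (K @ L) R = remaining r L (remaining r K R)"
  by (simp_all add: remaining_def)

lemma remaining_subset: "remaining r L R \<subseteq> R"
  by (induction L arbitrary: R) auto

lemma remaining_take_Suc:
  "a < length L \<Longrightarrow>
    remaining r (take (Suc a) L) R = remaining r (take a L) R - picks (r (L ! a)) (remaining r (take a L) R)"
  by (simp add: take_Suc_conv_app_nth)

lemma remaining_mono:
  assumes "\<And>i. i \<in> set L \<Longrightarrow> rank_function m (r i)" "R \<subseteq> S" "S \<subseteq> {..<m}"
  shows "remaining r L R \<subseteq> remaining r L S"
  using assms
proof (induction L arbitrary: R S)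
  case (Cons i L)
  then show ?case
    using rank_function.Diff_picks_mono[of m "r i" R S]
    by (simp add: Diff_subset[THEN subset_trans])
qed auto

definition insert_at :: "nat \<Rightarrow> 'a \<Rightarrow> 'a list \<Rightarrow> 'a list" where
  "insert_at p x L = take p L @ x # drop p L"

lemma remaining_insert_at_le:
  assumes "a \<le> p" "p \<le> length L"
  shows "remaining r (take a (insert_at p i L)) R = remaining r (take a L) R"
  using assms by (simp add: insert_at_def min_def)

text \<open>The agents behind position \<open>p\<close> act as before, but start from
  \<open>?S\<close> without the picks of \<open>i\<close> instead of from \<open>?S\<close>;
  monotonicity of \<open>remaining\<close> does the rest.\<close>

lemma remaining_insert_at_gt:
  assumes "\<And>i. i \<in> set L \<Longrightarrow> rank_function m (r i)" "R \<subseteq> {..<m}" "p \<le> a" "p \<le> length L"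
  shows "remaining r (take (Suc a) (insert_at p i L)) R \<subseteq> remaining r (take a L) R"
proof -
  let ?S = "remaining r (take p L) R"
  have "take (Suc a) (insert_at p i L) = take p L @ i # take (a - p) (drop p L)"
    using assms by (simp add: insert_at_def Suc_diff_le min_def)
  moreover have "take a L = take p L @ take (a - p) (drop p L)"
    using assms by (metis le_add_diff_inverse take_add)
  moreover have "remaining r (take (a - p) (drop p L)) (?S - picks (r i) ?S)
      \<subseteq> remaining r (take (a - p) (drop p L)) ?S"
    using assms remaining_subset[of r "take p L" R]
    by (intro remaining_mono[where m = m]) (auto dest!: in_set_takeD in_set_dropD)
  ultimately show ?thesis
    by simp
qed

text \<open>This is what allows a uniform order to be seen as an order of the others plus a uniform
  position for \<open>x\<close>. Injectivity holds because \<open>x\<close> occurs only once;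
  surjectivity follows by counting.\<close>

lemma bij_betw_insert_at:
  assumes "finite A" "x \<notin> A"
  shows "bij_betw (\<lambda>(L, p). insert_at p x L) (permutations_of_set A \<times> {..card A})
    (permutations_of_set (insert x A))"
  unfolding bij_betw_def
proof
  show inj: "inj_on (\<lambda>(L, p). insert_at p x L) (permutations_of_set A \<times> {..card A})"
  proof (intro inj_onI, clarsimp)
    fix K L p q
    assume K: "K \<in> permutations_of_set A" "p \<le> card A" and L: "L \<in> permutations_of_set A" "q \<le> card A"
      and eq: "insert_at p x K = insert_at q x L"
    then have "x \<notin> set K" "x \<notin> set L" "length K = card A" "length L = card A"
      using assms by (auto dest: permutations_of_setD length_finite_permutations_of_set)
    then have "take p K = take q L \<and> drop p K = drop q L"
      using eq unfolding insert_at_def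
      by (subst (asm) append_Cons_eq_iff) (auto dest: in_set_takeD in_set_dropD)
    moreover from this have "length (take p K) = length (take q L)"
      by simp
    ultimately show "K = L \<and> p = q"
      using K L \<open>length K = _\<close> \<open>length L = _\<close> by (metis append_take_drop_id length_take min.absorb2)
  qed
  show "(\<lambda>(L, p). insert_at p x L) ` (permutations_of_set A \<times> {..card A}) =
      permutations_of_set (insert x A)"
  proof (rule card_subset_eq)
    show "(\<lambda>(L, p). insert_at p x L) ` (permutations_of_set A \<times> {..card A})
        \<subseteq> permutations_of_set (insert x A)"
    proof clarify
      fix L p
      assume "L \<in> permutations_of_set A"
      then have "set L = A" "distinct L"
        by (auto dest: permutations_of_setD)
      moreover have "set (take p L) \<union> set (drop p L) = set L"
        by (metis append_take_drop_id set_append)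
      ultimately show "insert_at p x L \<in> permutations_of_set (insert x A)"
        using assms set_take_disj_set_drop_if_distinct[of L p p]
        by (auto simp: insert_at_def permutations_of_set_def dest: in_set_takeD in_set_dropD)
    qed
    show "card ((\<lambda>(L, p). insert_at p x L) ` (permutations_of_set A \<times> {..card A})) =
        card (permutations_of_set (insert x A))"
      using assms by (simp add: card_image[OF inj] card_cartesian_product)
  qed simp
qed

section \<open>Prices\<close>

text \<open>\<open>price n q\<close> is the mean of \<open>exp (y - 1)\<close> at the \<open>q\<close>-th smallest (from 0) of \<open>n\<close> independent
  uniform \<open>y \<in> [0, 1]\<close>; the definition is what integration by parts makes of this mean.\<close>

definition slope :: "nat \<Rightarrow> nat \<Rightarrow> real" where
  "slope n k = integral {0..1} (\<lambda>y. exp (y - 1) * Bernstein n k y)"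

definition price :: "nat \<Rightarrow> nat \<Rightarrow> real" where
  "price n q = 1 / exp 1 + (\<Sum>k\<le>q. slope n k)"

lemma continuous_on_Bernstein [continuous_intros]: "continuous_on S (Bernstein n k)"
  unfolding Bernstein_def by (intro continuous_intros)

lemma integrable_exp_Bernstein: "(\<lambda>y. exp (y - 1) * Bernstein n k y) integrable_on {0..1}"
  by (intro integrable_continuous_real continuous_intros)

lemma slope_nonneg: "0 \<le> slope n k"
  unfolding slope_def
  by (intro integral_nonneg integrable_exp_Bernstein) (auto simp: Bernstein_nonneg)

text \<open>The integrand is the derivative of \<open>exp (y - 1) * f y\<close>.\<close>

lemma integral_exp_add_deriv:
  assumes f: "\<And>y. (f has_real_derivative f' y) (at y)"
  shows "((\<lambda>y. exp (y - 1) * (f y + f' y)) has_integral (f 1 - f 0 / exp 1)) {0..1}"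
proof -
  have "((\<lambda>y. exp (y - 1) * (f y + f' y)) has_integral
      ((\<lambda>y. exp (y - 1) * f y) 1 - (\<lambda>y. exp (y - 1) * f y) 0)) {0..1}"
  proof (rule fundamental_theorem_of_calculus)
    fix y :: real
    have "((\<lambda>y. exp (y - 1) * f y) has_real_derivative exp (y - 1) * (f y + f' y)) (at y within {0..1})"
      by (rule derivative_eq_intros has_field_derivative_at_within[OF f] | simp add: algebra_simps)+
    then show "((\<lambda>y. exp (y - 1) * f y) has_vector_derivative exp (y - 1) * (f y + f' y)) (at y within {0..1})"
      by (simp add: has_real_derivative_iff_has_vector_derivative)
  qed simp
  then show ?thesis
    by (simp add: exp_diff exp_minus field_simps)
qed

lemma price_top: "price n n = 1"
proof -
  have "(\<Sum>k\<le>n. slope n k) = integral {0..1} (\<lambda>y. \<Sum>k\<le>n. exp (y - 1) * Bernstein n k y)"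
    unfolding slope_def by (intro integral_sum[symmetric] integrable_exp_Bernstein) auto
  \<comment> \<open>Bernstein polynomials of one degree sum to 1; \<open>1 + 0\<close> fits the
    pattern \<open>f y + f' y\<close> with \<open>f\<close> constant.\<close>
  also have "\<dots> = integral {0..1} (\<lambda>y. exp (y - 1) * (1 + 0))"
    by (simp flip: sum_distrib_left)
  also have "\<dots> = 1 - 1 / exp 1"
    by (intro integral_unique integral_exp_add_deriv) auto
  finally show ?thesis
    by (simp add: price_def)
qed

lemma price_Suc: "price n (Suc q) = price n q + slope n (Suc q)"
  by (simp add: price_def)

lemma price_le_1:
  assumes "q \<le> n"
  shows "price n q \<le> 1"
proof -
  have "(\<Sum>k\<le>q. slope n k) \<le> (\<Sum>k\<le>n. slope n k)"
    using assms by (intro sum_mono2) (auto simp: slope_nonneg)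
  then show ?thesis
    using price_top[of n] by (simp add: price_def)
qed

section \<open>Bernstein identities and the recurrence of the prices\<close>

lemma Bernstein_Suc_deriv:
  assumes "k < n"
  shows "(Bernstein (Suc n) (Suc k) has_real_derivative
    real (Suc n) * (Bernstein n k y - Bernstein n (Suc k) y)) (at y)"
proof -
  let ?c = "real (Suc n choose Suc k)"
  have c1: "?c * real (Suc k) = real (Suc n) * real (n choose k)"
    unfolding of_nat_mult[symmetric] using Suc_times_binomial_eq[of n k] by simp
  have c2: "?c * real (n - k) = real (Suc n) * real (n choose Suc k)"
    unfolding of_nat_mult[symmetric]
    using binomial_absorb_comp[of "Suc n" "Suc k"] by (simp add: mult.commute)
  have "((\<lambda>y. ?c * (y ^ Suc k * (1 - y) ^ (n - k))) has_real_derivative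
      ?c * (real (Suc k) * y ^ k * (1 - y) ^ (n - k)
        - real (n - k) * y ^ Suc k * (1 - y) ^ (n - Suc k))) (at y)"
    by (rule derivative_eq_intros refl | simp)+
  also have "?c * (real (Suc k) * y ^ k * (1 - y) ^ (n - k)
        - real (n - k) * y ^ Suc k * (1 - y) ^ (n - Suc k)) =
      (?c * real (Suc k)) * (y ^ k * (1 - y) ^ (n - k))
        - (?c * real (n - k)) * (y ^ Suc k * (1 - y) ^ (n - Suc k))"
    by (simp only: right_diff_distrib mult.assoc)
  also have "\<dots> = real (Suc n) * (Bernstein n k y - Bernstein n (Suc k) y)"
    unfolding c1 c2 Bernstein_def by (simp add: right_diff_distrib mult.assoc del: of_nat_Suc)
  finally show ?thesis
    by (simp add: Bernstein_def[abs_def] mult.assoc)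
qed

text \<open>The derivatives telescope. In probabilistic terms, the sum is the chance that at most
  \<open>q\<close> of \<open>Suc n\<close> uniform points lie below \<open>y\<close>, and its
  derivative is minus the density of an order statistic.\<close>

lemma sum_Bernstein_deriv:
  assumes "q \<le> n"
  shows "((\<lambda>y. \<Sum>k\<le>q. Bernstein (Suc n) k y) has_real_derivative
    - (real (Suc n) * Bernstein n q y)) (at y)"
  using assms
proof (induction q)
  case 0
  have "((\<lambda>y. (1 - y) ^ Suc n) has_real_derivative - (real (Suc n) * (1 - y) ^ n)) (at y)"
    by (rule derivative_eq_intros refl | simp)+
  then show ?case
    by (simp add: Bernstein_def)
next
  case (Suc q)
  have "((\<lambda>y. (\<Sum>k\<le>q. Bernstein (Suc n) k y) + Bernstein (Suc n) (Suc q) y) has_real_derivative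
      - (real (Suc n) * Bernstein n q y)
      + real (Suc n) * (Bernstein n q y - Bernstein n (Suc q) y)) (at y)"
    using Suc by (intro DERIV_add Bernstein_Suc_deriv) auto
  then show ?case
    by (simp add: algebra_simps)
qed

text \<open>Multiply \<open>Bernstein n q y\<close> by \<open>y + (1 - y)\<close> and absorb the
  factors into the binomial coefficients.\<close>

lemma Bernstein_degree_reduction:
  assumes "q \<le> n"
  shows "real (Suc q) * Bernstein (Suc n) (Suc q) y + real (Suc n - q) * Bernstein (Suc n) q y =
    real (Suc n) * Bernstein n q y"
proof -
  have c1: "real (Suc q) * real (Suc n choose Suc q) = real (Suc n) * real (n choose q)"
    unfolding of_nat_mult[symmetric] using Suc_times_binomial_eq[of n q] by (simp add: mult.commute)
  have c2: "real (Suc n - q) * real (Suc n choose q) = real (Suc n) * real (n choose q)"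
    unfolding of_nat_mult[symmetric] using binomial_absorb_comp[of "Suc n" q] by simp
  have "real (Suc q) * Bernstein (Suc n) (Suc q) y + real (Suc n - q) * Bernstein (Suc n) q y =
      (real (Suc q) * real (Suc n choose Suc q)) * (y * (y ^ q * (1 - y) ^ (n - q)))
      + (real (Suc n - q) * real (Suc n choose q)) * ((1 - y) * (y ^ q * (1 - y) ^ (n - q)))"
    using assms unfolding Bernstein_def
    by (simp add: Suc_diff_le mult_ac del: of_nat_Suc binomial_Suc_Suc)
  also have "\<dots> = real (Suc n) * Bernstein n q y"
    unfolding c1 c2 Bernstein_def by (simp add: algebra_simps)
  finally show ?thesis .
qed

text \<open>Let \<open>?F\<close> be the sum of the first \<open>q + 1\<close> Bernstein
  polynomials. By degree reduction the left-hand side is the integral of \<open>exp (y - 1)\<close>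
  times minus the derivative of \<open>?F\<close>. Integration by parts leaves
  \<open>price n q\<close>, the summand \<open>1 / exp 1\<close> being the boundary term at
  0.\<close>

lemma slope_recurrence:
  assumes "q < n"
  shows "real (Suc q) * slope n (Suc q) + real (n - q) * slope n q = price n q"
proof -
  obtain N where n: "n = Suc N" and q: "q \<le> N"
    using assms by (cases n) auto
  let ?F = "\<lambda>y. \<Sum>k\<le>q. Bernstein n k y"
  have int: "((\<lambda>y. exp (y - 1) * Bernstein n k y) has_integral slope n k) {0..1}" for k
    unfolding slope_def by (rule integrable_integral[OF integrable_exp_Bernstein])
  have "((\<lambda>y. \<Sum>k\<le>q. exp (y - 1) * Bernstein n k y) has_integral (\<Sum>k\<le>q. slope n k)) {0..1}"
    by (intro has_integral_sum int) auto
  moreover have "((\<lambda>y. real (Suc q) * (exp (y - 1) * Bernstein n (Suc q) y)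
      + real (n - q) * (exp (y - 1) * Bernstein n q y)) has_integral
      (real (Suc q) * slope n (Suc q) + real (n - q) * slope n q)) {0..1}"
    by (intro has_integral_add has_integral_mult_right int)
  ultimately have "((\<lambda>y. (\<Sum>k\<le>q. exp (y - 1) * Bernstein n k y)
      - (real (Suc q) * (exp (y - 1) * Bernstein n (Suc q) y)
      + real (n - q) * (exp (y - 1) * Bernstein n q y))) has_integral
      (\<Sum>k\<le>q. slope n k) - (real (Suc q) * slope n (Suc q) + real (n - q) * slope n q)) {0..1}"
    by (rule has_integral_diff)
  also have "(\<lambda>y. (\<Sum>k\<le>q. exp (y - 1) * Bernstein n k y)
      - (real (Suc q) * (exp (y - 1) * Bernstein n (Suc q) y)
      + real (n - q) * (exp (y - 1) * Bernstein n q y))) =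
      (\<lambda>y. exp (y - 1) * (?F y + - (real n * Bernstein N q y)))"
    unfolding n Bernstein_degree_reduction[OF q, symmetric]
    by (simp add: sum_distrib_left algebra_simps)
  finally have "(\<Sum>k\<le>q. slope n k) - (real (Suc q) * slope n (Suc q) + real (n - q) * slope n q) =
      ?F 1 - ?F 0 / exp 1"
    using integral_exp_add_deriv[OF sum_Bernstein_deriv[OF q]] unfolding n
    by (rule has_integral_unique)
  \<comment> \<open>Here \<open>q < n\<close> matters: among the Bernstein polynomials of degree
    \<open>n\<close> only the last is nonzero at 1.\<close>
  moreover have "?F 1 = 0"
    using assms by (auto simp: Bernstein_def power_0_left intro!: sum.neutral)
  moreover have "?F 0 = 1"
  proof -
    have "?F 0 = (\<Sum>k\<le>q. if k = 0 then 1 else 0)"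
      by (intro sum.cong) (auto simp: Bernstein_def)
    then show ?thesis
      by simp
  qed
  ultimately show ?thesis
    by (simp add: price_def)
qed

lemma sum_by_parts_price:
  "(\<Sum>a<n. (x a - x (Suc a)) * (1 - price n a)) = (1 - 1 / exp 1) * x 0 - (\<Sum>a\<le>n. x a * slope n a)"
proof -
  \<comment> \<open>Abel summation up to an arbitrary \<open>N\<close>. At \<open>N = n\<close> the
    boundary term becomes \<open>x n * slope n n\<close> by \<open>price_top\<close>, which is the
    last summand of the claim.\<close>
  have "(\<Sum>a<N. (x a - x (Suc a)) * (1 - price n a)) =
      (1 - 1 / exp 1) * x 0 - (\<Sum>a<N. x a * slope n a) - x N * (1 - price n N + slope n N)" for N
  proof (induction N)
    case 0
    show ?case
      by (simp add: price_def algebra_simps)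
  next
    case (Suc N)
    then show ?case
      by (simp add: price_Suc algebra_simps)
  qed
  from this[of n] show ?thesis
    by (simp add: price_top lessThan_Suc_atMost[symmetric])
qed

text \<open>An agent inserted at position \<open>p\<close> into an order of \<open>n - 1\<close> others delays every later agent
  by one position; summed over \<open>p\<close>, each \<open>z q\<close> is charged \<open>n - q\<close> times undelayed and \<open>Suc q\<close> times delayed.\<close>

lemma sum_over_insertions:
  fixes z I :: "nat \<Rightarrow> real"
  shows "(\<Sum>p<n. (\<Sum>a\<le>p. z a * I a) + (\<Sum>a\<in>{p..<n}. z a * I (Suc a))) =
    (\<Sum>q<n. z q * (real (Suc q) * I (Suc q) + real (n - q) * I q))"
proof (induction n)
  case (Suc n)
  define W where "W p = (\<Sum>a\<le>p. z a * I a) + (\<Sum>a\<in>{p..<n}. z a * I (Suc a))" for p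
  define Q where "Q q = z q * (real (Suc q) * I (Suc q) + real (n - q) * I q)" for q
  \<comment> \<open>Each old \<open>p\<close> gains the delayed term of the new index
    \<open>n\<close>; the new \<open>p = n\<close> delays that index alone.\<close>
  have "(\<Sum>p<Suc n. (\<Sum>a\<le>p. z a * I a) + (\<Sum>a\<in>{p..<Suc n}. z a * I (Suc a))) =
      (\<Sum>p<n. W p + z n * I (Suc n)) + ((\<Sum>a<n. z a * I a) + z n * I n) + z n * I (Suc n)"
    by (simp add: W_def lessThan_Suc_atMost[symmetric] add.assoc)
  also have "\<dots> = (\<Sum>p<n. W p) + (\<Sum>a<n. z a * I a) + z n * (real (Suc n) * I (Suc n) + I n)"
    by (simp add: sum.distrib algebra_simps)
  also have "(\<Sum>p<n. W p) = (\<Sum>q<n. Q q)"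
    unfolding W_def Q_def by (rule Suc)
  also have "(\<Sum>q<n. Q q) + (\<Sum>a<n. z a * I a) = (\<Sum>q<n. Q q + z q * I q)"
    by (simp add: sum.distrib)
  also have "\<dots> = (\<Sum>q<n. z q * (real (Suc q) * I (Suc q) + real (Suc n - q) * I q))"
    by (intro sum.cong) (auto simp: Q_def Suc_diff_le algebra_simps)
  finally show ?case
    by simp
qed simp

section \<open>Competitive analysis\<close>

lemma insert_at_nth_eq_iff:
  assumes "p \<le> length L" "a \<le> length L" "x \<notin> set L"
  shows "insert_at p x L ! a = x \<longleftrightarrow> a = p"
proof -
  have "L ! b \<noteq> x" if "b < length L" for b
    using assms(3) nth_mem[OF that] by auto
  then show ?thesis
    using assms by (auto simp: insert_at_def nth_append nth_Cons split: nat.split)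
qed

locale ranked_agents =
  fixes n m :: nat and r :: "nat \<Rightarrow> nat set \<Rightarrow> nat"
  assumes rank_function_agent: "i < n \<Longrightarrow> rank_function m (r i)"
begin

abbreviation orders :: "nat list set" where
  "orders \<equiv> permutations_of_set {..<n}"

abbreviation left_over :: "nat list \<Rightarrow> nat \<Rightarrow> nat set" where
  "left_over L a \<equiv> remaining r (take a L) {..<m}"

definition order_value :: "nat list \<Rightarrow> nat" where
  "order_value L = (\<Sum>a<n. r (L ! a) (left_over L a))"

lemma left_over_subset: "left_over L a \<subseteq> {..<m}"
  by (rule remaining_subset)

lemma finite_left_over: "finite (left_over L a)"
  using left_over_subset finite_subset by blast

text \<open>For a fixed order, each unit of rank is split into the agent's share
  \<open>price n a\<close> and the credit \<open>1 - price n a\<close> of the picked item. By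
  \<open>sum_by_parts_price\<close> the second summand is the total credit of \<open>B i\<close>,
  and disjointness ensures that no item is credited twice.\<close>

lemma order_value_ge:
  assumes L: "L \<in> orders" and "disjoint_family_on B {..<n}" and B: "\<And>i. i < n \<Longrightarrow> B i \<subseteq> {..<m}"
  shows "(\<Sum>i<n. (\<Sum>a<n. if L ! a = i then r i (left_over L a) * price n a else 0)
      + ((1 - 1 / exp 1) * card (B i) - (\<Sum>a\<le>n. card (left_over L a \<inter> B i) * slope n a)))
    \<le> order_value L"
proof -
  have len: "length L = n" and set: "set L = {..<n}"
    using L by (auto dest: permutations_of_setD length_finite_permutations_of_set)
  have agent: "L ! a < n" if "a < n" for a
    using nth_mem[of a L] that len set by simp
  define x where "x i a = real (card (left_over L a \<inter> B i))" for i a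
  \<comment> \<open>The difference \<open>x i a - x i (Suc a)\<close> counts the elements of
    \<open>B i\<close> picked at position \<open>a\<close>.\<close>
  have step: "(\<Sum>i<n. x i a - x i (Suc a)) \<le> r (L ! a) (left_over L a)" if "a < n" for a
  proof -
    let ?P = "picks (r (L ! a)) (left_over L a)"
    have P: "?P \<subseteq> left_over L a"
      by (rule picks_subset)
    have Suc: "left_over L (Suc a) = left_over L a - ?P"
      using remaining_take_Suc[of a L] that len by simp
    have "x i a - x i (Suc a) = card (?P \<inter> B i)" for i
    proof -
      have "left_over L a \<inter> B i = (left_over L (Suc a) \<inter> B i) \<union> (?P \<inter> B i)"
        using Suc P by blast
      also have "card \<dots> = card (left_over L (Suc a) \<inter> B i) + card (?P \<inter> B i)"
        using Suc P finite_left_over[of a L] finite_subset[OF P]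
        by (intro card_Un_disjoint) auto
      finally show ?thesis
        by (simp add: x_def)
    qed
    then have "(\<Sum>i<n. x i a - x i (Suc a)) = (\<Sum>i<n. card (?P \<inter> B i))"
      by simp
    also have "(\<Sum>i<n. card (?P \<inter> B i)) = card (\<Union>i<n. ?P \<inter> B i)"
      using assms finite_subset[OF P finite_left_over]
      by (intro card_UN_disjoint[symmetric]) (auto simp: disjoint_family_on_def)
    also have "\<dots> \<le> card ?P"
      using finite_subset[OF P finite_left_over] by (intro card_mono) auto
    also have "\<dots> = r (L ! a) (left_over L a)"
      by (rule rank_function.card_picks[OF rank_function_agent[OF agent[OF that]] left_over_subset])
    finally show ?thesis
      by simp
  qed
  have "(\<Sum>i<n. (1 - 1 / exp 1) * card (B i) - (\<Sum>a\<le>n. x i a * slope n a)) =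
      (\<Sum>i<n. \<Sum>a<n. (x i a - x i (Suc a)) * (1 - price n a))"
  proof (intro sum.cong refl)
    fix i assume "i \<in> {..<n}"
    then have "card (B i) = x i 0"
      using B[of i] by (simp add: x_def Int_absorb1)
    then show "(1 - 1 / exp 1) * card (B i) - (\<Sum>a\<le>n. x i a * slope n a) =
        (\<Sum>a<n. (x i a - x i (Suc a)) * (1 - price n a))"
      by (simp add: sum_by_parts_price)
  qed
  also have "\<dots> = (\<Sum>a<n. (\<Sum>i<n. x i a - x i (Suc a)) * (1 - price n a))"
    by (subst sum.swap) (simp add: sum_distrib_right)
  also have "\<dots> \<le> (\<Sum>a<n. r (L ! a) (left_over L a) * (1 - price n a))"
    using step price_le_1 by (intro sum_mono mult_right_mono) auto
  finally have 1: "(\<Sum>i<n. (1 - 1 / exp 1) * card (B i) - (\<Sum>a\<le>n. x i a * slope n a))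
      \<le> (\<Sum>a<n. r (L ! a) (left_over L a) * (1 - price n a))" .
  have "(\<Sum>i<n. \<Sum>a<n. if L ! a = i then r i (left_over L a) * price n a else 0) =
      (\<Sum>a<n. \<Sum>i<n. if L ! a = i then r i (left_over L a) * price n a else 0)"
    by (rule sum.swap)
  also have "\<dots> = (\<Sum>a<n. r (L ! a) (left_over L a) * price n a)"
  proof (intro sum.cong refl)
    fix a assume "a \<in> {..<n}"
    then have "L ! a < n"
      using agent by simp
    then show "(\<Sum>i<n. if L ! a = i then r i (left_over L a) * price n a else 0) =
        r (L ! a) (left_over L a) * price n a"
      by (simp add: sum.delta')
  qed
  finally have 2: "(\<Sum>i<n. \<Sum>a<n. if L ! a = i then r i (left_over L a) * price n a else 0) =
      (\<Sum>a<n. r (L ! a) (left_over L a) * price n a)" .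
  have "real (order_value L) = (\<Sum>a<n. r (L ! a) (left_over L a) * price n a)
      + (\<Sum>a<n. r (L ! a) (left_over L a) * (1 - price n a))"
    unfolding sum.distrib[symmetric] order_value_def by (simp add: algebra_simps)
  then show ?thesis
    using 1 unfolding x_def sum.distrib 2 by linarith
qed

lemma sum_orders:
  assumes "i < n"
  shows "(\<Sum>L\<in>orders. F L) =
    (\<Sum>K\<in>permutations_of_set ({..<n} - {i}). \<Sum>p<n. F (insert_at p i K))"
proof -
  let ?A = "{..<n} - {i}"
  have "{..card ?A} = {..<n}"
    using assms by auto
  moreover have "insert i ?A = {..<n}"
    using assms by auto
  ultimately have "bij_betw (\<lambda>(K, p). insert_at p i K) (permutations_of_set ?A \<times> {..<n}) orders"
    using bij_betw_insert_at[of ?A i] by simp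
  from sum.reindex_bij_betw[OF this, of F, symmetric] show ?thesis
    by (simp add: sum.cartesian_product case_prod_unfold)
qed

text \<open>The core of the analysis: averaged over its own position, the share of \<open>i\<close>
  makes up for the credit that its basis \<open>B\<close> misses. It is enough to compare both sides
  for each order \<open>K\<close> of the other agents.\<close>

lemma sum_orders_agent:
  assumes i: "i < n" and B: "B \<subseteq> {..<m}" "r i B = card B"
  shows "(\<Sum>L\<in>orders. \<Sum>a\<le>n. card (left_over L a \<inter> B) * slope n a)
    \<le> (\<Sum>L\<in>orders. \<Sum>a<n. if L ! a = i then r i (left_over L a) * price n a else 0)"
  unfolding sum_orders[OF i]
proof (rule sum_mono)
  fix K assume K: "K \<in> permutations_of_set ({..<n} - {i})"
  then have len: "length K = n - 1" and set: "set K = {..<n} - {i}"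
    using i by (auto dest: permutations_of_setD length_finite_permutations_of_set)
  define z where "z q = real (card (left_over K q \<inter> B))" for q
  \<comment> \<open>Up to position \<open>p\<close> nothing differs from \<open>K\<close>; behind
    it, position \<open>Suc a\<close> is offered at most what position \<open>a\<close> of
    \<open>K\<close> was. Since slopes are nonnegative, this bounds the sum.\<close>
  have "(\<Sum>a\<le>n. card (left_over (insert_at p i K) a \<inter> B) * slope n a)
      \<le> (\<Sum>a\<le>p. z a * slope n a) + (\<Sum>a\<in>{p..<n}. z a * slope n (Suc a))" if "p < n" for p
  proof -
    have "{..n} = {..p} \<union> {Suc p..<Suc n}" "{..p} \<inter> {Suc p..<Suc n} = {}"
      using that by auto
    then have "(\<Sum>a\<le>n. card (left_over (insert_at p i K) a \<inter> B) * slope n a) =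
        (\<Sum>a\<le>p. card (left_over (insert_at p i K) a \<inter> B) * slope n a)
        + (\<Sum>a\<in>{Suc p..<Suc n}. card (left_over (insert_at p i K) a \<inter> B) * slope n a)"
      by (simp only: sum.union_disjoint finite_atMost finite_atLeastLessThan)
    also have "(\<Sum>a\<le>p. card (left_over (insert_at p i K) a \<inter> B) * slope n a) =
        (\<Sum>a\<le>p. z a * slope n a)"
      using that len by (intro sum.cong) (auto simp: z_def remaining_insert_at_le)
    also have "(\<Sum>a\<in>{Suc p..<Suc n}. card (left_over (insert_at p i K) a \<inter> B) * slope n a) =
        (\<Sum>a\<in>{p..<n}. card (left_over (insert_at p i K) (Suc a) \<inter> B) * slope n (Suc a))"
      by (rule sum.shift_bounds_Suc_ivl)
    also have "\<dots> \<le> (\<Sum>a\<in>{p..<n}. z a * slope n (Suc a))"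
    proof (intro sum_mono mult_right_mono slope_nonneg)
      fix a assume "a \<in> {p..<n}"
      then have "left_over (insert_at p i K) (Suc a) \<subseteq> left_over K a"
        using that len set rank_function_agent by (intro remaining_insert_at_gt[where m = m]) auto
      then show "real (card (left_over (insert_at p i K) (Suc a) \<inter> B)) \<le> z a"
        unfolding z_def using finite_left_over[of a K] by (intro of_nat_mono card_mono) auto
    qed
    finally show ?thesis
      by simp
  qed
  then have "(\<Sum>p<n. \<Sum>a\<le>n. card (left_over (insert_at p i K) a \<inter> B) * slope n a)
      \<le> (\<Sum>p<n. (\<Sum>a\<le>p. z a * slope n a) + (\<Sum>a\<in>{p..<n}. z a * slope n (Suc a)))"
    by (intro sum_mono) auto
  also have "\<dots> = (\<Sum>q<n. z q * price n q)"
    unfolding sum_over_insertions by (intro sum.cong refl) (simp only: lessThan_iff slope_recurrence)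
  also have "\<dots> \<le> (\<Sum>q<n. r i (left_over K q) * price n q)"
    unfolding z_def using rank_function.card_Int_le_rank[OF rank_function_agent[OF i] left_over_subset B]
    by (intro sum_mono mult_right_mono) (auto simp: price_def slope_nonneg intro!: add_nonneg_nonneg sum_nonneg)
  \<comment> \<open>Agent \<open>i\<close> stands only at position \<open>p\<close>, where it is
    offered exactly \<open>left_over K p\<close>.\<close>
  also have "\<dots> = (\<Sum>p<n. \<Sum>a<n. if insert_at p i K ! a = i
      then r i (left_over (insert_at p i K) a) * price n a else 0)"
  proof (intro sum.cong refl)
    fix p assume p: "p \<in> {..<n}"
    then have "(\<Sum>a<n. if insert_at p i K ! a = i
        then r i (left_over (insert_at p i K) a) * price n a else 0) =
      (\<Sum>a<n. if a = p then r i (left_over (insert_at p i K) a) * price n a else 0)"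
      using len set by (intro sum.cong) (auto simp: insert_at_nth_eq_iff)
    also have "\<dots> = r i (left_over (insert_at p i K) p) * price n p"
      using p by simp
    finally show "r i (left_over K p) * price n p = (\<Sum>a<n. if insert_at p i K ! a = i
        then r i (left_over (insert_at p i K) a) * price n a else 0)"
      using p len by (simp add: remaining_insert_at_le)
  qed
  finally show "(\<Sum>p<n. \<Sum>a\<le>n. card (left_over (insert_at p i K) a \<inter> B) * slope n a)
    \<le> (\<Sum>p<n. \<Sum>a<n. if insert_at p i K ! a = i
        then r i (left_over (insert_at p i K) a) * price n a else 0)" .
qed

lemma expected_order_value_ge:
  assumes disj: "disjoint_family_on B {..<n}"
    and B: "\<And>i. i < n \<Longrightarrow> B i \<subseteq> {..<m}" "\<And>i. i < n \<Longrightarrow> r i (B i) = card (B i)"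
  shows "(1 - 1 / exp 1) * (\<Sum>i<n. card (B i))
    \<le> measure_pmf.expectation (pmf_of_set orders) (\<lambda>L. order_value L)"
proof -
  let ?c = "1 - 1 / exp 1 :: real"
  let ?gain = "\<lambda>i L. \<Sum>a<n. if L ! a = i then r i (left_over L a) * price n a else 0"
  let ?loss = "\<lambda>i L. \<Sum>a\<le>n. card (left_over L a \<inter> B i) * slope n a"
  have "(\<Sum>i<n. \<Sum>L\<in>orders. ?c * card (B i)) \<le>
      (\<Sum>i<n. (\<Sum>L\<in>orders. ?c * card (B i)) + ((\<Sum>L\<in>orders. ?gain i L) - (\<Sum>L\<in>orders. ?loss i L)))"
    \<comment> \<open>The added difference of gain and loss is nonnegative for every single agent,
      once summed over the orders.\<close>
    using sum_orders_agent[OF _ B] by (intro sum_mono) simp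
  also have "\<dots> = (\<Sum>i<n. \<Sum>L\<in>orders. ?gain i L + (?c * card (B i) - ?loss i L))"
    unfolding sum.distrib sum_subtractf by (simp add: algebra_simps)
  also have "\<dots> = (\<Sum>L\<in>orders. \<Sum>i<n. ?gain i L + (?c * card (B i) - ?loss i L))"
    by (rule sum.swap)
  also have "\<dots> \<le> (\<Sum>L\<in>orders. real (order_value L))"
    by (intro sum_mono order_value_ge disj B)
  finally have "card orders * (?c * (\<Sum>i<n. card (B i))) \<le> (\<Sum>L\<in>orders. real (order_value L))"
    by (simp add: sum_distrib_left mult_ac)
  moreover have "card orders > 0"
    by (simp add: card_gt_0_iff)
  ultimately show ?thesis
    by (subst integral_pmf_of_set) (auto simp: pos_le_divide_eq mult.commute)
qed

end

section \<open>Uniformly random orders\<close>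

text \<open>The displaced entry moves to the end and \<open>x\<close> takes its position. For
  \<open>p = length L\<close> the unspecified \<open>L ! p\<close> is overwritten at once.\<close>

definition place :: "'a \<Rightarrow> nat \<Rightarrow> 'a list \<Rightarrow> 'a list" where
  "place x p L = (L @ [L ! p])[p := x]"

lemma length_place [simp]: "length (place x p L) = Suc (length L)"
  by (simp add: place_def)

lemma nth_place:
  "p \<le> length L \<Longrightarrow> a \<le> length L \<Longrightarrow>
    place x p L ! a = (if a = p then x else if a < length L then L ! a else L ! p)"
  by (auto simp: place_def nth_list_update nth_append)

lemma mset_place:
  assumes "p \<le> length L"
  shows "mset (place x p L) = add_mset x (mset L)"
proof (cases "p = length L")
  case False
  then show ?thesis
    using assms by (simp add: place_def mset_update nth_append)
qed (simp add: place_def)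

text \<open>The position of \<open>x\<close> reveals \<open>p\<close>, and the displaced entry is
  found at the end; surjectivity is again by counting.\<close>

lemma bij_betw_place:
  assumes "finite A" "x \<notin> A"
  shows "bij_betw (\<lambda>(L, p). place x p L) (permutations_of_set A \<times> {0..card A})
    (permutations_of_set (insert x A))"
  unfolding bij_betw_def
proof
  show inj: "inj_on (\<lambda>(L, p). place x p L) (permutations_of_set A \<times> {0..card A})"
  proof (intro inj_onI, clarsimp)
    fix K L p q
    assume K: "K \<in> permutations_of_set A" "p \<le> card A" and L: "L \<in> permutations_of_set A" "q \<le> card A"
      and eq: "place x p K = place x q L"
    then have len: "length K = card A" "length L = card A"
      by (auto dest: length_finite_permutations_of_set)
    have nx: "M ! a \<noteq> x" if "M \<in> permutations_of_set A" "a < card A" for M a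
    proof -
      have "set M = A" "length M = card A"
        using that by (auto dest: permutations_of_setD length_finite_permutations_of_set)
      then show ?thesis
        using that(2) assms(2) nth_mem[of a M] by auto
    qed
    have nth_eq: "place x p K ! a = place x q L ! a" for a
      using eq by simp
    have "p = q"
    proof (rule ccontr)
      assume "p \<noteq> q"
      then have "place x q L ! p \<noteq> x"
        using K L len nx[OF L(1)] by (auto simp: nth_place)
      then show False
        using nth_eq[of p] K len by (simp add: nth_place)
    qed
    moreover have "K = L"
    proof (rule nth_equalityI)
      fix a assume "a < length K"
      then show "K ! a = L ! a"
        using nth_eq[of a] nth_eq[of "card A"] K L len \<open>p = q\<close>
        by (cases "a = p") (auto simp: nth_place)
    qed (simp add: len)
    ultimately show "K = L \<and> p = q"
      by simp
  qed
  show "(\<lambda>(L, p). place x p L) ` (permutations_of_set A \<times> {0..card A}) =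
      permutations_of_set (insert x A)"
  proof (rule card_subset_eq)
    show "(\<lambda>(L, p). place x p L) ` (permutations_of_set A \<times> {0..card A})
        \<subseteq> permutations_of_set (insert x A)"
    proof clarify
      fix L p
      assume "L \<in> permutations_of_set A" "p \<in> {0..card A}"
      then show "place x p L \<in> permutations_of_set (insert x A)"
        using assms length_finite_permutations_of_set[of L A]
        by (simp add: permutations_of_set_altdef permutations_of_multiset_def mset_place)
    qed
    show "card ((\<lambda>(L, p). place x p L) ` (permutations_of_set A \<times> {0..card A})) =
        card (permutations_of_set (insert x A))"
      using assms by (simp add: card_image[OF inj] card_cartesian_product)
  qed simp
qed

text \<open>The inside-out Fisher--Yates shuffle.\<close>

primrec shuffle :: "nat \<Rightarrow> nat list \<Rightarrow> nat list pmf" where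
  "shuffle 0 L = return_pmf L"
| "shuffle (Suc k) L =
     bind_pmf (pmf_of_set {0..length L}) (\<lambda>p. shuffle k (place (length L) p L))"

text \<open>Starting from a uniform order of \<open>j\<close> agents makes the induction work: by
  \<open>bij_betw_place\<close>, one placement turns it into a uniform order of \<open>Suc j\<close>
  agents.\<close>

lemma bind_shuffle:
  "bind_pmf (pmf_of_set (permutations_of_set {..<j})) (shuffle k) =
    pmf_of_set (permutations_of_set {..<j + k})"
proof (induction k arbitrary: j)
  case 0
  then show ?case
    by (simp add: bind_return_pmf')
next
  case (Suc k)
  let ?O = "\<lambda>j. permutations_of_set {..<j} :: nat list set"
  have len: "length L = j" if "L \<in> ?O j" for L
    using length_finite_permutations_of_set[OF that] by simp
  have "bind_pmf (pmf_of_set (?O j)) (shuffle (Suc k)) =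
      bind_pmf (pmf_of_set (?O j)) (\<lambda>L. bind_pmf (pmf_of_set {0..j}) (\<lambda>p. shuffle k (place j p L)))"
    by (intro bind_pmf_cong) (auto simp: len)
  also have "\<dots> = bind_pmf (pair_pmf (pmf_of_set (?O j)) (pmf_of_set {0..j}))
      (\<lambda>x. shuffle k ((\<lambda>(L, p). place j p L) x))"
    by (simp add: pair_pmf_def bind_assoc_pmf bind_return_pmf)
  also have "pair_pmf (pmf_of_set (?O j)) (pmf_of_set {0..j}) = pmf_of_set (?O j \<times> {0..j})"
    by (rule pmf_eqI) (auto simp: pmf_pair indicator_def algebra_simps)
  also have "bind_pmf (pmf_of_set (?O j \<times> {0..j})) (\<lambda>x. shuffle k ((\<lambda>(L, p). place j p L) x)) =
      bind_pmf (map_pmf (\<lambda>(L, p). place j p L) (pmf_of_set (?O j \<times> {0..j}))) (shuffle k)"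
    by (simp add: bind_map_pmf)
  also have "map_pmf (\<lambda>(L, p). place j p L) (pmf_of_set (?O j \<times> {0..j})) = pmf_of_set (?O (Suc j))"
    using bij_betw_place[of "{..<j}" j]
    by (intro map_pmf_of_set_bij_betw) (auto simp: lessThan_Suc)
  finally show ?case
    using Suc by simp
qed

lemma shuffle_Nil: "shuffle n [] = pmf_of_set (permutations_of_set {..<n})"
  using bind_shuffle[of 0 n] by (simp add: bind_return_pmf pmf_of_set_singleton)

section \<open>Running the program\<close>

lemma var_set_var [simp]: "var (set_var x v s) y = (if y = x then v else var s y)"
  by (simp add: set_var_def)

lemma arr_set_var [simp]: "arr (set_var x v s) = arr s"
  by (simp add: set_var_def)

lemma var_set_arr [simp]: "var (set_arr a i j v s) = var s"
  by (simp add: set_arr_def)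

lemma arr_set_arr_other [simp]: "b \<noteq> a \<Longrightarrow> arr (set_arr a i j v s) b = arr s b"
  by (simp add: set_arr_def)

lemma arr_set_arr [simp]:
  "arr (set_arr a i j v s) b c d = (if b = a \<and> c = i \<and> d = j then v else arr s b c d)"
  by (simp add: set_arr_def)

text \<open>A coupling: \<open>\<mu>\<close> is the distribution of an abstract result, here an
  order of the agents, and \<open>Q\<close> relates that result to the final state. Quantifying over
  all larger \<open>T\<close> lets step bounds be rounded up.\<close>

definition yields ::
    "(nat \<Rightarrow> nat set \<Rightarrow> nat) \<Rightarrow> nat \<Rightarrow> config \<Rightarrow> 'a pmf \<Rightarrow> ('a \<Rightarrow> state \<Rightarrow> bool) \<Rightarrow> bool" where
  "yields g N q \<mu> Q \<longleftrightarrow> (\<forall>T\<ge>N. rel_pmf (\<lambda>x (cs, s). cs = [] \<and> Q x s) \<mu> (steps g T q))"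

lemma yields_mono: "yields g N q \<mu> Q \<Longrightarrow> N \<le> M \<Longrightarrow> yields g M q \<mu> Q"
  by (simp add: yields_def)

lemma steps_halted: "steps g T ([], s) = return_pmf ([], s)"
  by (induction T) (auto simp: bind_return_pmf)

lemma yields_halted: "Q x s \<Longrightarrow> yields g N ([], s) (return_pmf x) Q"
  by (simp add: yields_def steps_halted)

lemma yields_step:
  assumes "step g q = return_pmf q'"
  shows "yields g (Suc N) q \<mu> Q \<longleftrightarrow> yields g N q' \<mu> Q"
proof -
  have "steps g (Suc T) q = steps g T q'" for T
    using assms by (simp add: bind_return_pmf)
  moreover have "(\<forall>T\<ge>Suc N. P T) \<longleftrightarrow> (\<forall>T\<ge>N. P (Suc T))" for P
    by (metis Suc_le_D Suc_le_mono)
  ultimately show ?thesis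
    unfolding yields_def by simp
qed

lemma yields_simps:
  "yields g (Suc N) (Assign x e # cs, s) \<mu> Q \<longleftrightarrow> yields g N (cs, set_var x (aval e s) s) \<mu> Q"
  "yields g (Suc N) (Store a d e v # cs, s) \<mu> Q \<longleftrightarrow>
    yields g N (cs, set_arr a (aval d s) (aval e s) (aval v s) s) \<mu> Q"
  "yields g (Suc N) (Query x e a i # cs, s) \<mu> Q \<longleftrightarrow>
    yields g N (cs, set_var x (g (aval e s) {t. arr s a (aval i s) t \<noteq> 0}) s) \<mu> Q"
  "yields g (Suc N) (Seq c c' # cs, s) \<mu> Q \<longleftrightarrow> yields g N (c # c' # cs, s) \<mu> Q"
  "yields g (Suc N) (Cond b c c' # cs, s) \<mu> Q \<longleftrightarrow>
    yields g N ((if bval b s then c else c') # cs, s) \<mu> Q"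
  by (simp_all add: yields_step)

lemma yields_While:
  "yields g (Suc N) (While b c # cs, s) \<mu> Q \<longleftrightarrow>
    yields g N (if bval b s then c # While b c # cs else cs, s) \<mu> Q"
  by (simp add: yields_step)

text \<open>The draw of the program is coupled with the identical draw on the abstract side.\<close>

lemma yields_Draw:
  assumes "\<And>v. v \<le> aval e s \<Longrightarrow> yields g N (cs, set_var x v s) (\<mu> v) Q"
  shows "yields g (Suc N) (Draw x e # cs, s) (bind_pmf (pmf_of_set {0..aval e s}) \<mu>) Q"
  unfolding yields_def
proof (intro allI impI)
  fix T assume "Suc N \<le> T"
  then obtain T' where T: "T = Suc T'" "N \<le> T'"
    by (cases T) auto
  show "rel_pmf (\<lambda>x (cs, s). cs = [] \<and> Q x s)
      (bind_pmf (pmf_of_set {0..aval e s}) \<mu>) (steps g T (Draw x e # cs, s))"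
    unfolding T steps.simps step.simps
  proof (rule rel_pmf_bindI)
    show "rel_pmf (\<lambda>v q. v \<le> aval e s \<and> q = (cs, set_var x v s)) (pmf_of_set {0..aval e s})
        (map_pmf (\<lambda>v. (cs, set_var x v s)) (pmf_of_set {0..aval e s}))"
      by (auto simp: pmf.rel_map intro!: rel_pmf_reflI)
  qed (use assms T in \<open>auto simp: yields_def\<close>)
qed

definition shuffle_loop :: com where
  "shuffle_loop = While (Less (Var ''k'') (Var ''agents''))
    (Seq (Draw ''p'' (Var ''k''))
    (Seq (Store ''P'' (Const 0) (Var ''k'') (Read ''P'' (Const 0) (Var ''p'')))
    (Seq (Store ''P'' (Const 0) (Var ''p'') (Var ''k''))
         (Assign ''k'' (Plus (Var ''k'') (Const 1))))))"

text \<open>Row \<open>a\<close> of \<open>R\<close> collects every item offered to the agent in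
  position \<open>a\<close>, whether accepted or not, so \<open>v\<close> and \<open>w\<close> are
  the two ranks compared in \<open>picks\<close>. Setting \<open>a\<close> to \<open>agents\<close>
  leaves the loop.\<close>

definition search_loop :: com where
  "search_loop = While (Less (Var ''a'') (Var ''agents''))
    (Seq (Query ''v'' (Read ''P'' (Const 0) (Var ''a'')) ''R'' (Var ''a''))
    (Seq (Store ''R'' (Var ''a'') (Var ''item'') (Const 1))
    (Seq (Query ''w'' (Read ''P'' (Const 0) (Var ''a'')) ''R'' (Var ''a''))
         (Cond (Less (Var ''v'') (Var ''w''))
           (Seq (Assign ''agent'' (Read ''P'' (Const 0) (Var ''a'')))
                (Assign ''a'' (Var ''agents'')))
           (Assign ''a'' (Plus (Var ''a'') (Const 1)))))))"

text \<open>The counter \<open>k\<close> of the shuffle survives between arrivals, so that only the first arrival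
  shuffles.\<close>

definition ranking :: com where
  "ranking = Seq shuffle_loop (Seq (Assign ''agent'' (Const 0)) (Seq (Assign ''a'' (Const 0)) search_loop))"

definition order_stored :: "nat \<Rightarrow> nat list \<Rightarrow> state \<Rightarrow> bool" where
  "order_stored n L s \<longleftrightarrow> var s ''agents'' = n \<and> var s ''k'' = length L \<and>
    map (arr s ''P'' 0) [0..<length L] = L"

lemma order_stored_nth: "order_stored n L s \<Longrightarrow> a < length L \<Longrightarrow> arr s ''P'' 0 a = L ! a"
  unfolding order_stored_def by (metis add.left_neutral diff_zero length_upt nth_map nth_upt)

lemma order_stored_place:
  assumes "order_stored n L s" "p \<le> length L"
  shows "order_stored n (place (length L) p L)
    (set_var ''k'' (Suc (length L)) (set_arr ''P'' 0 p (length L)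
      (set_arr ''P'' 0 (length L) (arr s ''P'' 0 p) (set_var ''p'' p s))))"
proof -
  \<comment> \<open>For \<open>p = length L\<close> the cell read lies outside the stored order; the
    second store overwrites its copy.\<close>
  have "arr s ''P'' 0 p = L ! p" if "p \<noteq> length L"
    using order_stored_nth[OF assms(1)] assms(2) that by simp
  then show ?thesis
    using assms order_stored_nth[OF assms(1)]
    unfolding order_stored_def
    by (auto intro!: nth_equalityI simp: nth_place simp del: upt_Suc)
qed

text \<open>Stated for an arbitrary continuation \<open>cs\<close>. A round costs 8 steps: loop
  test, three \<open>Seq\<close>, one draw, two stores and one assignment; \<open>Suc\<close> is the
  failing test. If \<open>L\<close> is already complete, only that test is executed.\<close>

lemma yields_shuffle_loop:
  assumes "order_stored n L s" "length L \<le> n"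
    and "\<And>L' s'. L' \<in> set_pmf (shuffle (n - length L) L) \<Longrightarrow> order_stored n L' s' \<Longrightarrow> arr s' ''R'' = arr s ''R'' \<Longrightarrow>
      var s' ''item'' = var s ''item'' \<Longrightarrow> yields g N (cs, s') (\<mu> L') Q"
  shows "yields g (8 * (n - length L) + Suc N) (shuffle_loop # cs, s)
    (bind_pmf (shuffle (n - length L) L) \<mu>) Q"
  using assms
proof (induction "n - length L" arbitrary: L s)
  case 0
  then have "length L = n"
    by simp
  moreover have "yields g N (cs, s) (\<mu> L) Q"
    using 0 \<open>length L = n\<close> by simp
  ultimately show ?case
    using 0(2) by (simp add: shuffle_loop_def yields_While order_stored_def bind_return_pmf)
next
  case (Suc d)
  then have d: "n - length L = Suc d" "length L < n" and k: "var s ''k'' = length L" "var s ''agents'' = n"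
    by (auto simp: order_stored_def)
  let ?s = "\<lambda>p. set_var ''k'' (Suc (length L)) (set_arr ''P'' 0 p (length L)
      (set_arr ''P'' 0 (length L) (arr s ''P'' 0 p) (set_var ''p'' p s)))"
  have IH: "yields g (8 * d + Suc N) (shuffle_loop # cs, ?s p)
      (bind_pmf (shuffle d (place (length L) p L)) \<mu>) Q" if "p \<le> length L" for p
  proof -
    have d': "n - length (place (length L) p L) = d"
      using d by simp
    have "L' \<in> set_pmf (shuffle (n - length L) L)" if "L' \<in> set_pmf (shuffle d (place (length L) p L))" for L'
      using that \<open>p \<le> length L\<close> d by auto
    then have "yields g N (cs, s') (\<mu> L') Q"
      if "L' \<in> set_pmf (shuffle d (place (length L) p L))" "order_stored n L' s'"
        "arr s' ''R'' = arr (?s p) ''R''" "var s' ''item'' = var (?s p) ''item''" for L' s'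
      using that by (intro Suc.prems(3)) auto
    then    show ?thesis
      using Suc.hyps(1)[of "place (length L) p L" "?s p"] order_stored_place[OF Suc.prems(1) that]
        d unfolding d' by simp
  qed
  have draw: "yields g (Suc (5 + (8 * d + Suc N)))
      (Draw ''p'' (Var ''k'') #
        Seq (Store ''P'' (Const 0) (Var ''k'') (Read ''P'' (Const 0) (Var ''p'')))
        (Seq (Store ''P'' (Const 0) (Var ''p'') (Var ''k''))
         (Assign ''k'' (Plus (Var ''k'') (Const 1)))) # shuffle_loop # cs, s)
      (bind_pmf (pmf_of_set {0..aval (Var ''k'') s})
        (\<lambda>p. bind_pmf (shuffle d (place (length L) p L)) \<mu>)) Q"
  proof (rule yields_Draw)
    fix p assume "p \<le> aval (Var ''k'') s"
    then show "yields g (5 + (8 * d + Suc N))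
      (Seq (Store ''P'' (Const 0) (Var ''k'') (Read ''P'' (Const 0) (Var ''p'')))
        (Seq (Store ''P'' (Const 0) (Var ''p'') (Var ''k''))
         (Assign ''k'' (Plus (Var ''k'') (Const 1)))) # shuffle_loop # cs, set_var ''p'' p s)
      (bind_pmf (shuffle d (place (length L) p L)) \<mu>) Q"
      using IH[of p] k by (simp add: numeral_eq_Suc yields_simps del: mult_Suc)
  qed
  have "8 * (n - length L) + Suc N = Suc (Suc (Suc (5 + (8 * d + Suc N))))"
    using d by simp
  moreover have "yields g (Suc (Suc M)) (shuffle_loop # cs, s) D Q"
    if "yields g M (Draw ''p'' (Var ''k'') #
        Seq (Store ''P'' (Const 0) (Var ''k'') (Read ''P'' (Const 0) (Var ''p'')))
        (Seq (Store ''P'' (Const 0) (Var ''p'') (Var ''k''))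
         (Assign ''k'' (Plus (Var ''k'') (Const 1)))) # shuffle_loop # cs, s) D Q" for M D
    using that d k by (simp add: shuffle_loop_def yields_While yields_simps)
  note this[OF draw]
  ultimately show ?case
    using d k by (simp only: shuffle.simps bind_assoc_pmf aval.simps)
qed

section \<open>The allocation computed online\<close>

locale arrivals =
  fixes n m :: nat and f :: "nat \<Rightarrow> nat set \<Rightarrow> nat" and \<pi> :: "nat \<Rightarrow> nat"
  assumes utilities: "matroid_rank_utilities n m f" and bij: "bij_betw \<pi> {..<m} {..<m}"
begin

definition r :: "nat \<Rightarrow> nat set \<Rightarrow> nat" where
  "r i S = f i (\<pi> ` S)"

sublocale ranked_agents n m r
proof (rule ranked_agents.intro)
  fix i assume "i < n"
  then obtain indep where "matroid {..<m} indep" "\<And>S. S \<subseteq> {..<m} \<Longrightarrow> f i S = matroid_rank indep S"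
    using utilities by (auto simp: matroid_rank_utilities_def)
  then show "rank_function m (r i)"
    unfolding r_def[abs_def] using bij by (intro rank_function_image) (auto simp: bij_betw_def)
qed

lemma n_pos: "0 < n"
  using utilities by (simp add: matroid_rank_utilities_def)

lemma r_preimage:
  "r i {t. t < m \<and> \<sigma> (\<pi> t) = i} = f i {j. j < m \<and> \<sigma> j = i}"
proof -
  have "\<pi> ` {t. t < m \<and> \<sigma> (\<pi> t) = i} = {j. j < m \<and> \<sigma> j = i}"
  proof
    show "{j. j < m \<and> \<sigma> j = i} \<subseteq> \<pi> ` {t. t < m \<and> \<sigma> (\<pi> t) = i}"
    proof
      fix j assume j: "j \<in> {j. j < m \<and> \<sigma> j = i}"
      then have "j \<in> \<pi> ` {..<m}"
        using bij by (simp add: bij_betw_def)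
      then show "j \<in> \<pi> ` {t. t < m \<and> \<sigma> (\<pi> t) = i}"
        using j by auto
    qed
  qed (use bij in \<open>auto simp: bij_betw_def\<close>)
  then show ?thesis
    by (simp add: r_def)
qed

lemma optimal_welfare_le:
  "(1 - 1 / exp 1) * real (optimal_welfare n m f)
    \<le> measure_pmf.expectation (pmf_of_set orders) (\<lambda>L. order_value L)"
proof -
  have "optimal_welfare n m f \<in> welfare n m f ` ({..<m} \<rightarrow>\<^sub>E {..<n})"
    unfolding optimal_welfare_def using n_pos
    by (intro Max_in) (auto simp: finite_PiE PiE_eq_empty_iff)
  then obtain \<sigma> where \<sigma>: "optimal_welfare n m f = welfare n m f \<sigma>"
    by auto
  \<comment> \<open>The optimal shares in terms of positions. Their greedy bases serve as the sets
    \<open>B i\<close>: they are disjoint, and their sizes add up to the optimum.\<close>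
  define R where "R i = {t. t < m \<and> \<sigma> (\<pi> t) = i}" for i
  have R: "R i \<subseteq> {..<m}" for i
    by (auto simp: R_def)
  note rank_function.card_picks[OF rank_function_agent R]
    and rank_function.rank_picks[OF rank_function_agent R]
  note picks = this
  have "disjoint_family_on (\<lambda>i. picks (r i) (R i)) {..<n}"
    by (auto simp: disjoint_family_on_def picks_def R_def)
  then have "(1 - 1 / exp 1) * (\<Sum>i<n. card (picks (r i) (R i)))
      \<le> measure_pmf.expectation (pmf_of_set orders) (\<lambda>L. order_value L)"
    using subset_trans[OF picks_subset R] by (intro expected_order_value_ge) (simp_all add: picks)
  also have "(\<Sum>i<n. card (picks (r i) (R i))) = optimal_welfare n m f"
    unfolding \<sigma> welfare_def by (intro sum.cong refl) (simp add: picks, simp add: R_def r_preimage)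
  finally show ?thesis .
qed

section \<open>From an order of the agents to an allocation\<close>

lemma left_over_Suc:
  assumes "L \<in> orders" "a < n"
  shows "left_over L (Suc a) = left_over L a - picks (r (L ! a)) (left_over L a)"
  using assms remaining_take_Suc[of a L r "{..<m}"] length_finite_permutations_of_set[of L "{..<n}"]
  by simp

lemma left_over_antimono:
  assumes "a \<le> b"
  shows "left_over L b \<subseteq> left_over L a"
proof -
  have "take b L = take a L @ take (b - a) (drop a L)"
    using assms by (metis le_add_diff_inverse take_add)
  then show ?thesis
    using remaining_subset[of r "take (b - a) (drop a L)" "left_over L a"] by simp
qed

lemma orderD:
  assumes "L \<in> orders"
  shows "length L = n" "set L = {..<n}" "distinct L" "a < n \<Longrightarrow> L ! a < n"
proof -
  show *: "length L = n" "set L = {..<n}" "distinct L"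
    using assms by (auto dest: permutations_of_setD length_finite_permutations_of_set)
  show "L ! a < n" if "a < n"
    using nth_mem[of a L] that * by simp
qed

text \<open>Items that no agent wants still have to be given away; they go to agent 0.\<close>

definition assigned_agent :: "nat list \<Rightarrow> nat \<Rightarrow> nat" where
  "assigned_agent L t = (if t \<in> left_over L n then 0 else L ! (LEAST a. t \<notin> left_over L (Suc a)))"

text \<open>Left-over sets only shrink, so the position at which \<open>t\<close> is picked is the
  first one after which \<open>t\<close> is missing.\<close>

lemma assigned_agent_picks:
  assumes L: "L \<in> orders" and a: "a < n" and t: "t \<in> picks (r (L ! a)) (left_over L a)"
  shows "assigned_agent L t = L ! a"
proof -
  have out: "t \<notin> left_over L (Suc a)"
    using t left_over_Suc[OF L a] by blast
  then have "t \<notin> left_over L n"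
    using left_over_antimono[of "Suc a" n L] a by auto
  moreover have "(LEAST a. t \<notin> left_over L (Suc a)) = a"
  proof (rule Least_equality)
    show "t \<notin> left_over L (Suc a)"
      by (rule out)
    fix b assume b: "t \<notin> left_over L (Suc b)"
    have "t \<in> left_over L a"
      using t picks_subset by blast
    then show "a \<le> b"
      using left_over_antimono[of "Suc b" a L] b by (meson not_less_eq_eq subsetD)
  qed
  ultimately show ?thesis
    by (simp add: assigned_agent_def)
qed

primrec allocation :: "nat list \<Rightarrow> nat \<Rightarrow> nat \<Rightarrow> nat" where
  "allocation L 0 = (\<lambda>_. undefined)"
| "allocation L (Suc t) = (allocation L t)(\<pi> t := assigned_agent L t)"

lemma allocation_arrived:
  assumes "t \<le> m" "u < t"
  shows "allocation L t (\<pi> u) = assigned_agent L u"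
  using assms
proof (induction t)
  case (Suc t)
  then have "\<pi> u = \<pi> t \<longleftrightarrow> u = t"
    using inj_on_eq_iff[OF bij_betw_imp_inj_on[OF bij], of u t] by simp
  then show ?case
    using Suc by auto
qed simp

text \<open>Every agent receives at least its picks, which have the full rank of what it was
  offered; further items cannot lower its utility.\<close>

lemma order_value_le_welfare:
  assumes L: "L \<in> orders"
  shows "order_value L \<le> welfare n m f (allocation L m)"
proof -
  let ?U = "\<lambda>i. {t. t < m \<and> allocation L m (\<pi> t) = i}"
  have "order_value L = (\<Sum>a<n. r (L ! a) (picks (r (L ! a)) (left_over L a)))"
    unfolding order_value_def
    using rank_function.rank_picks[OF rank_function_agent left_over_subset] orderD(4)[OF L]
    by (intro sum.cong) auto
  also have "\<dots> \<le> (\<Sum>a<n. r (L ! a) (?U (L ! a)))"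
  proof (rule sum_mono)
    fix a assume a: "a \<in> {..<n}"
    show "r (L ! a) (picks (r (L ! a)) (left_over L a)) \<le> r (L ! a) (?U (L ! a))"
    proof (rule rank_function.rank_mono[OF rank_function_agent])
      show "picks (r (L ! a)) (left_over L a) \<subseteq> ?U (L ! a)"
      proof
        fix t assume t: "t \<in> picks (r (L ! a)) (left_over L a)"
        then have "t < m"
          using picks_subset left_over_subset by blast
        then show "t \<in> ?U (L ! a)"
          using assigned_agent_picks[OF L _ t] allocation_arrived[of m t L] a by simp
      qed
    qed (use a orderD[OF L] in auto)
  qed
  also have "\<dots> = (\<Sum>i<n. r i (?U i))"
    by (rule sum.reindex_bij_betw, rule bij_betw_nth) (simp_all add: orderD[OF L])
  also have "\<dots> = welfare n m f (allocation L m)"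
    by (simp add: welfare_def r_preimage)
  finally show ?thesis .
qed

text \<open>The invariant linking the online run to the agent-by-agent view. The bound
  \<open>k\<close> depends on the row because, while item \<open>t\<close> is being offered, only
  the rows already visited include it.\<close>

definition rows :: "nat list \<Rightarrow> (nat \<Rightarrow> nat) \<Rightarrow> state \<Rightarrow> bool" where
  "rows L k s \<longleftrightarrow> (\<forall>a<n. {t. arr s ''R'' a t \<noteq> 0} = left_over L a \<inter> {..<k a})"

abbreviation answer :: "nat \<Rightarrow> nat \<Rightarrow> nat set \<Rightarrow> nat" where
  "answer t \<equiv> value_oracle n f \<pi> (Suc t)"

lemma answer_eq: "i < n \<Longrightarrow> S \<subseteq> {..t} \<Longrightarrow> answer t i S = r i S"
  by (simp add: value_oracle_def r_def Int_absorb2 lessThan_Suc_atMost)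

text \<open>The factor 11 is the cost of an accepting round, 8 steps through \<open>Cond\<close> and
  3 in its branch; a rejecting round needs 9. The extra step is the final test.\<close>

lemma yields_search_loop:
  assumes L: "L \<in> orders" and t: "t < m" and a: "a \<le> n"
    and s: "order_stored n L s" "var s ''item'' = t" "var s ''a'' = a" "var s ''agent'' = 0"
    and rows: "rows L (\<lambda>b. if b < a then Suc t else t) s" and left: "t \<in> left_over L a"
  shows "yields (answer t) (Suc (11 * (n - a))) ([search_loop], s) (return_pmf L)
    (\<lambda>L s'. order_stored n L s' \<and> rows L (\<lambda>_. Suc t) s' \<and> var s' ''agent'' = assigned_agent L t)"
    (is "yields _ _ _ _ ?Q")
  using a s rows left
proof (induction "n - a" arbitrary: a s)
  \<comment> \<open>Nobody wanted \<open>t\<close>; the default 0 still stored in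
    \<open>agent\<close> is what \<open>assigned_agent\<close> prescribes.\<close>
  case 0
  then have "a = n"
    by simp
  with 0 show ?case
    by (simp add: search_loop_def yields_While order_stored_def rows_def assigned_agent_def yields_halted)
next
  case (Suc d)
  then have an: "a < n" and La: "L ! a < n" and d: "n - a = Suc d" "n - Suc a = d"
    using orderD[OF L] by auto
  let ?S = "left_over L a"
  have row: "{u. arr s ''R'' a u \<noteq> 0} = ?S \<inter> {..<t}"
    using Suc.prems an by (simp add: rows_def)
  have upto: "insert t (?S \<inter> {..<t}) = ?S \<inter> {..t}"
    using Suc.prems by auto
  have P: "arr s ''P'' 0 a = L ! a"
    using order_stored_nth[OF Suc.prems(2)] an orderD[OF L] by simp
  define v where "v = r (L ! a) (?S \<inter> {..<t})"
  define w where "w = r (L ! a) (?S \<inter> {..t})"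
  define s' where "s' = set_var ''w'' w (set_arr ''R'' a t 1 (set_var ''v'' v s))"
  have row': "{u. arr (set_arr ''R'' a t 1 (set_var ''v'' v s)) ''R'' a u \<noteq> 0} = ?S \<inter> {..t}"
    using row upto by auto
  have s'_stored: "order_stored n L s'"
    using Suc.prems by (simp add: s'_def order_stored_def)
  have s'_rows: "rows L (\<lambda>b. if b < Suc a then Suc t else t) s'"
    unfolding rows_def
  proof (intro allI impI)
    fix b assume "b < n"
    then show "{u. arr s' ''R'' b u \<noteq> 0} = left_over L b \<inter> {..<if b < Suc a then Suc t else t}"
      using Suc.prems row' by (cases "b = a") (auto simp: s'_def rows_def lessThan_Suc_atMost)
  qed
  have picked: "t \<in> picks (r (L ! a)) ?S \<longleftrightarrow> v < w"
    using Suc.prems by (simp add: picks_def v_def w_def)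
  have answers: "answer t (L ! a) (?S \<inter> {..<t}) = v" "answer t (L ! a) (?S \<inter> {..t}) = w"
    using La unfolding v_def w_def by (auto intro!: answer_eq[OF La])
  let ?take = "Seq (Assign ''agent'' (Read ''P'' (Const 0) (Var ''a''))) (Assign ''a'' (Var ''agents''))"
  let ?next = "Assign ''a'' (Plus (Var ''a'') (Const 1))"
  have body: "yields (answer t) (Suc (Suc (Suc (Suc (Suc (Suc (Suc (Suc M)))))))) ([search_loop], s)
        (return_pmf L) ?Q \<longleftrightarrow>
      yields (answer t) M ([if v < w then ?take else ?next, search_loop], s') (return_pmf L) ?Q" for M
  proof -
    have "var s ''agents'' = n"
      using Suc.prems by (simp add: order_stored_def)
    then show ?thesis
      using Suc.prems an P row row' answers
      by (simp add: search_loop_def yields_While yields_simps s'_def)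
  qed
  show ?case
  proof (cases "v < w")
    case True
    then have picked: "t \<in> picks (r (L ! a)) ?S"
      using picked by simp
    define s'' where "s'' = set_var ''a'' n (set_var ''agent'' (L ! a) s')"
    have "rows L (\<lambda>_. Suc t) s''"
      unfolding rows_def
    proof (intro allI impI)
      fix b assume b: "b < n"
      \<comment> \<open>The rows behind \<open>a\<close> are untouched but already correct, since a
        picked item is left over for nobody later.\<close>
      have "t \<notin> left_over L b" if "a < b"
        using left_over_antimono[of "Suc a" b L] that left_over_Suc[OF L an] picked by auto
      then show "{u. arr s'' ''R'' b u \<noteq> 0} = left_over L b \<inter> {..<Suc t}"
        using s'_rows b by (cases "a < b") (auto simp: rows_def s''_def less_Suc_eq)
    qed
    moreover have "order_stored n L s''" "var s'' ''agent'' = assigned_agent L t" "var s'' ''a'' = n"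
      using s'_stored assigned_agent_picks[OF L an picked] by (auto simp: s''_def order_stored_def)
    ultimately have "yields (answer t) (Suc 0) ([search_loop], s'') (return_pmf L) ?Q"
      by (simp add: search_loop_def yields_While order_stored_def yields_halted)
    then have "yields (answer t) (Suc (Suc (Suc (Suc 0)))) ([?take, search_loop], s') (return_pmf L) ?Q"
      using s'_stored P Suc.prems by (simp add: yields_simps s''_def s'_def order_stored_def)
    then have "yields (answer t) (Suc (Suc (Suc (Suc (Suc (Suc (Suc (Suc (Suc (Suc (Suc (Suc 0))))))))))))
        ([search_loop], s) (return_pmf L) ?Q"
      using True by (simp only: body if_True)
    then show ?thesis
      by (rule yields_mono) (simp add: d)
  next
    case False
    then have "t \<in> left_over L (Suc a)"
      using picked left_over_Suc[OF L an] Suc.prems by simp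
    then have "yields (answer t) (Suc (11 * d)) ([search_loop], set_var ''a'' (Suc a) s') (return_pmf L) ?Q"
      using Suc.hyps(1)[of "Suc a" "set_var ''a'' (Suc a) s'"] d an s'_stored s'_rows Suc.prems
      by (simp add: order_stored_def rows_def s'_def)
    then have "yields (answer t) (Suc (Suc (11 * d))) ([?next, search_loop], s') (return_pmf L) ?Q"
      using Suc.prems by (simp add: yields_simps s'_def)
    then have "yields (answer t) (Suc (Suc (Suc (Suc (Suc (Suc (Suc (Suc (Suc (Suc (11 * d)))))))))))
        ([search_loop], s) (return_pmf L) ?Q"
      using False by (simp only: body if_False)
    then show ?thesis
      by (rule yields_mono) (simp add: d)
  qed
qed

lemma assigned_agent_less:
  assumes L: "L \<in> orders" and t: "t < m"
  shows "assigned_agent L t < n"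
proof (cases "t \<in> left_over L n")
  case False
  obtain k where k: "n = Suc k"
    using n_pos by (cases n) auto
  then have "(LEAST a. t \<notin> left_over L (Suc a)) \<le> k"
    using False by (intro Least_le) simp
  then have "(LEAST a. t \<notin> left_over L (Suc a)) < n"
    using k by simp
  then show ?thesis
    using False orderD(4)[OF L] by (simp only: assigned_agent_def if_False)
qed (simp add: assigned_agent_def n_pos)

text \<open>The budget is at most \<open>8 * n\<close> for the shuffle, \<open>11 * n\<close> for
  the search, and 7 for the two failing tests, three \<open>Seq\<close> and two assignments outside
  the loops. The last premise covers both an empty \<open>K\<close> at the first arrival and a
  complete \<open>K\<close> later.\<close>

lemma yields_ranking:
  assumes K: "order_stored n K s" "length K \<le> n" and t: "var s ''item'' = t" "t < m"
    and L: "\<And>L. L \<in> set_pmf (shuffle (n - length K) K) \<Longrightarrow> L \<in> orders \<and> rows L (\<lambda>_. t) s"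
  shows "yields (answer t) (19 * n + 7) ([ranking], s) (shuffle (n - length K) K)
    (\<lambda>L s'. order_stored n L s' \<and> rows L (\<lambda>_. Suc t) s' \<and> var s' ''agent'' = assigned_agent L t)"
    (is "yields _ _ _ _ ?Q")
proof -
  let ?rest = "Seq (Assign ''agent'' (Const 0)) (Seq (Assign ''a'' (Const 0)) search_loop)"
  let ?N = "Suc (Suc (Suc (Suc (Suc (11 * n)))))"
  have "yields (answer t) (8 * (n - length K) + Suc ?N) (shuffle_loop # [?rest], s)
      (bind_pmf (shuffle (n - length K) K) return_pmf) ?Q"
  proof (rule yields_shuffle_loop[OF K])
    fix L s'
    assume L': "L \<in> set_pmf (shuffle (n - length K) K)"
      and s': "order_stored n L s'" "arr s' ''R'' = arr s ''R''" "var s' ''item'' = var s ''item''"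
    let ?s = "set_var ''a'' 0 (set_var ''agent'' 0 s')"
    have "yields (answer t) (Suc (11 * (n - 0))) ([search_loop], ?s) (return_pmf L) ?Q"
    proof (rule yields_search_loop)
      show "L \<in> orders" "t < m" "0 \<le> n"
        using L L' t by auto
      show "order_stored n L ?s" "var ?s ''item'' = t" "var ?s ''a'' = 0" "var ?s ''agent'' = 0"
        using s' t by (auto simp: order_stored_def)
      show "rows L (\<lambda>b. if b < 0 then Suc t else t) ?s"
        using L[OF L'] s' by (simp add: rows_def)
      show "t \<in> left_over L 0"
        using t by simp
    qed
    then show "yields (answer t) ?N ([?rest], s') (return_pmf L) ?Q"
      by (simp add: yields_simps)
  qed
  then have "yields (answer t) (Suc (8 * (n - length K) + Suc ?N)) ([ranking], s) (shuffle (n - length K) K) ?Q"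
    by (simp only: ranking_def yields_simps bind_return_pmf')
  then show ?thesis
    by (rule yields_mono) simp
qed

section \<open>From a single arrival to the whole run\<close>

definition served :: "nat \<Rightarrow> nat list \<Rightarrow> state \<Rightarrow> bool" where
  "served t L s \<longleftrightarrow> L \<in> orders \<and> order_stored n L s \<and> rows L (\<lambda>_. t) s"

lemma serve_ranking:
  assumes K: "order_stored n K s" "length K \<le> n" and t: "t < m" and T: "19 * n + 7 \<le> T"
    and L: "\<And>L. L \<in> set_pmf (shuffle (n - length K) K) \<Longrightarrow> L \<in> orders \<and> rows L (\<lambda>_. t) s"
  shows "rel_pmf (\<lambda>L x. \<exists>s'. x = Some s' \<and> served (Suc t) L s' \<and> var s' ''agent'' = assigned_agent L t)
    (shuffle (n - length K) K) (serve ranking n f \<pi> T t s)"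
proof -
  have "yields (answer t) (19 * n + 7) ([ranking], set_var ''item'' t s) (shuffle (n - length K) K)
    (\<lambda>L s'. order_stored n L s' \<and> rows L (\<lambda>_. Suc t) s' \<and> var s' ''agent'' = assigned_agent L t)"
    using K t L by (intro yields_ranking) (auto simp: order_stored_def rows_def)
  then have "rel_pmf (\<lambda>L (cs, s'). cs = [] \<and> order_stored n L s' \<and> rows L (\<lambda>_. Suc t) s' \<and>
      var s' ''agent'' = assigned_agent L t) (shuffle (n - length K) K)
      (steps (answer t) T ([ranking], set_var ''item'' t s))"
    using T by (simp add: yields_def)
  then show ?thesis
    unfolding serve_def pmf.rel_map
    by (rule pmf.rel_mono_strong) (use L t in \<open>auto simp: served_def assigned_agent_less\<close>)
qed

text \<open>One uniform order is coupled with the entire run. The first arrival generates it by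
  \<open>shuffle_Nil\<close>; afterwards the stored order is complete, the shuffle has no rounds
  left, and every arrival is deterministic given \<open>L\<close>.\<close>

lemma play_ranking:
  assumes "t < m" and T: "19 * n + 7 \<le> T"
  shows "rel_pmf (\<lambda>L x. \<exists>s. x = Some (s, allocation L (Suc t)) \<and> served (Suc t) L s)
    (pmf_of_set orders) (play ranking n f \<pi> T (Suc t))"
  using assms(1)
proof (induction t)
  case 0
  have "rel_pmf (\<lambda>L x. \<exists>s'. x = Some s' \<and> served (Suc 0) L s' \<and> var s' ''agent'' = assigned_agent L 0)
      (shuffle (n - length ([] :: nat list)) []) (serve ranking n f \<pi> T 0 (initial_state n))"
  proof (rule serve_ranking)
    show "0 < m" "19 * n + 7 \<le> T"
      using 0 T by auto
    show "order_stored n [] (initial_state n)" "length ([] :: nat list) \<le> n"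
      by (auto simp: order_stored_def initial_state_def)
    fix L assume "L \<in> set_pmf (shuffle (n - length ([] :: nat list)) [])"
    then show "L \<in> orders \<and> rows L (\<lambda>_. 0) (initial_state n)"
      by (simp add: shuffle_Nil rows_def initial_state_def)
  qed
  then have "rel_pmf (\<lambda>L x. \<exists>s'. x = Some s' \<and> served (Suc 0) L s' \<and> var s' ''agent'' = assigned_agent L 0)
      (pmf_of_set orders) (serve ranking n f \<pi> T 0 (initial_state n))"
    by (simp add: shuffle_Nil)
  then show ?case
    by (auto simp: pmf.rel_map fun_eq_iff elim!: pmf.rel_mono_strong)
next
  case (Suc t)
  \<comment> \<open>The trivial bind with \<open>return_pmf\<close> gives the left side the same
    shape as \<open>play\<close>, so that \<open>rel_pmf_bindI\<close> applies.\<close>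
  have "rel_pmf (\<lambda>L x. \<exists>s. x = Some (s, allocation L (Suc (Suc t))) \<and> served (Suc (Suc t)) L s)
      (bind_pmf (pmf_of_set orders) return_pmf) (play ranking n f \<pi> T (Suc (Suc t)))"
    unfolding play.simps(2)[of _ _ _ _ _ "Suc t"] bind_spmf_def
  proof (rule rel_pmf_bindI)
    show "rel_pmf (\<lambda>L x. \<exists>s. x = Some (s, allocation L (Suc t)) \<and> served (Suc t) L s)
        (pmf_of_set orders) (play ranking n f \<pi> T (Suc t))"
      by (rule Suc.IH[OF Suc_lessD[OF Suc.prems]])
    fix L x
    assume "\<exists>s. x = Some (s, allocation L (Suc t)) \<and> served (Suc t) L s"
    then obtain s where x: "x = Some (s, allocation L (Suc t))" and s: "served (Suc t) L s"
      by blast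
    then have L: "L \<in> orders" "length L = n"
      using orderD by (auto simp: served_def)
    have "rel_pmf (\<lambda>L x. \<exists>s'. x = Some s' \<and> served (Suc (Suc t)) L s' \<and>
        var s' ''agent'' = assigned_agent L (Suc t))
        (shuffle (n - length L) L) (serve ranking n f \<pi> T (Suc t) s)"
      using s Suc.prems T L by (intro serve_ranking) (auto simp: served_def)
    then have "rel_pmf (\<lambda>L x. \<exists>s'. x = Some s' \<and> served (Suc (Suc t)) L s' \<and>
        var s' ''agent'' = assigned_agent L (Suc t))
        (return_pmf L) (serve ranking n f \<pi> T (Suc t) s)"
      using L by simp
    then show "rel_pmf (\<lambda>L x. \<exists>s. x = Some (s, allocation L (Suc (Suc t))) \<and> served (Suc (Suc t)) L s)
        (return_pmf L)
        (case x of None \<Rightarrow> return_pmf None | Some (s, \<sigma>) \<Rightarrow>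
          map_spmf (\<lambda>s'. (s', \<sigma>(\<pi> (Suc t) := var s' ''agent''))) (serve ranking n f \<pi> T (Suc t) s))"
      by (auto simp: x pmf.rel_map elim!: pmf.rel_mono_strong)
  qed
  then show ?case
    by (simp only: bind_return_pmf')
qed

lemma online_allocation_ranking:
  assumes T: "19 * n + 7 \<le> T"
  shows "online_allocation ranking n f \<pi> T m =
    spmf_of_pmf (map_pmf (\<lambda>L. allocation L m) (pmf_of_set orders))"
proof (cases m)
  \<comment> \<open>Without arrivals no order is ever drawn, so \<open>play_ranking\<close> does not
    apply; both sides are the constant undefined allocation.\<close>
  case 0
  have "map_pmf (\<lambda>L. allocation L 0) (pmf_of_set orders) = return_pmf (\<lambda>_. undefined)"
    by (simp only: allocation.simps map_pmf_const)
  then show ?thesis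
    unfolding 0 by (simp add: online_allocation_def)
next
  case (Suc t)
  have "rel_pmf (\<lambda>L x. x = Some (allocation L m)) (pmf_of_set orders) (online_allocation ranking n f \<pi> T m)"
    using play_ranking[OF _ T, of t] unfolding Suc online_allocation_def pmf.rel_map
    by (auto elim!: pmf.rel_mono_strong)
  then have "rel_pmf (=) (map_pmf (\<lambda>L. Some (allocation L m)) (pmf_of_set orders))
      (online_allocation ranking n f \<pi> T m)"
    unfolding pmf.rel_map by (auto elim!: pmf.rel_mono_strong)
  then show ?thesis
    by (simp add: pmf.rel_eq spmf_of_pmf_def pmf.map_comp o_def)
qed

lemma ranking_competitive:
  assumes "19 * n + 7 \<le> T"
  shows "lossless_spmf (online_allocation ranking n f \<pi> T m)"
    and "(1 - 1 / exp 1) * real (optimal_welfare n m f)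
      \<le> (\<integral>\<sigma>. real (welfare n m f \<sigma>) \<partial>measure_spmf (online_allocation ranking n f \<pi> T m))"
proof -
  show "lossless_spmf (online_allocation ranking n f \<pi> T m)"
    by (simp add: online_allocation_ranking[OF assms])
  have "measure_pmf.expectation (pmf_of_set orders) (\<lambda>L. order_value L)
      \<le> measure_pmf.expectation (pmf_of_set orders) (\<lambda>L. welfare n m f (allocation L m))"
    using order_value_le_welfare
    by (subst (1 2) integral_pmf_of_set) (auto intro!: divide_right_mono sum_mono)
  then show "(1 - 1 / exp 1) * real (optimal_welfare n m f)
      \<le> (\<integral>\<sigma>. real (welfare n m f \<sigma>) \<partial>measure_spmf (online_allocation ranking n f \<pi> T m))"
    using optimal_welfare_le by (simp add: online_allocation_ranking[OF assms])
qed

end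

theorem theorem1p4:
  shows "\<exists>(c :: com) (p :: nat poly).
    \<forall>(n :: nat) (m :: nat) (f :: nat \<Rightarrow> nat set \<Rightarrow> nat) (\<pi> :: nat \<Rightarrow> nat).
      matroid_rank_utilities n m f \<longrightarrow> bij_betw \<pi> {..<m} {..<m} \<longrightarrow>
      (let D = online_allocation c n f \<pi> (poly p (n + m)) m in
        lossless_spmf D \<and>
        (\<integral>\<sigma>. real (welfare n m f \<sigma>) \<partial>measure_spmf D)
          \<ge> (1 - 1 / exp 1) * real (optimal_welfare n m f))"
proof (intro exI allI impI)
  fix n m f \<pi>
  assume "matroid_rank_utilities n m f" "bij_betw \<pi> {..<m} {..<m}"
  then interpret arrivals n m f \<pi>
    by unfold_locales
  have "19 * n + 7 \<le> poly [:7, 19:] (n + m)"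
    by simp
  from ranking_competitive[OF this] show "let D = online_allocation ranking n f \<pi> (poly [:7, 19:] (n + m)) m in
      lossless_spmf D \<and>
      (\<integral>\<sigma>. real (welfare n m f \<sigma>) \<partial>measure_spmf D)
        \<ge> (1 - 1 / exp 1) * real (optimal_welfare n m f)"
    by (simp add: Let_def)
qed

end
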